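(* Let $X$ be a finitely based natural class. Then either (1) $X=\mathrm{Sub}(\gamma)\oplus S$ where $\gamma$ is a finite permutation and $S$ is a sum-complete closed set which is uniquely determined by $X$; or (2) $X=\mathrm{Sub}(\pi)$ where $\pi$ is the unique bijection $\mathbb{N}\to\mathbb{N}$ with $X=\mathrm{Sub}(\pi)$, and $\pi$ is ultimately periodic in the sense that there exist integers $N$ and $P>0$ such that $\pi(n+P)=\pi(n)+P$ for all $n\geq N$.
   Context: $\mathbb{N}=\{1,2,\ldots\}$. A permutation of length $n$ is an arrangement of $1,\ldots,n$. Two finite sequences of distinct numbers $a_1\cdots a_n$, $b_1\cdots b_n$ are order isomorphic if $a_i<a_j$ iff $b_i<b_j$ for all $i,j$. $\alpha\preceq\beta$ ($\alpha$ is involved in $\beta$) means $\alpha$ is order isomorphic to a subsequence of $\beta$. A closed set is a set $X$ of finite permutations with $\alpha\in X,\ \delta\preceq\alpha\Rightarrow\delta\in X$; its basis is the set of permutations not in $X$ all of whose proper involved permutations lie in $X$, and $X$ is finitely based if its basis is finite. For a bijection $\pi:\mathbb{N}\to\mathbb{N}$, or a finite permutation $\pi$, $\mathrm{Sub}(\pi)$ is the set of finite permutations order isomorphic to subsequences $\pi(c_1)\cdots\pi(c_n)$, $c_1<\cdots<c_n$. A natural class is a set of the form $\mathrm{Sub}(\pi)$ with $\pi:\mathbb{N}\to\mathbb{N}$ a bijection. For a permutation $\alpha$ of length $m$ and a permutation $\beta$, $\alpha\oplus\beta$ is $\alpha$ followed by $\beta$ with every entry of $\beta$ increased by $m$; for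 sets, $X\oplus Y=\{\sigma\oplus\tau:\sigma\in X,\tau\in Y\}$. A set $X$ of permutations is sum-complete if $\alpha\oplus\beta\in X$ for all $\alpha,\beta\in X$. "$S$ uniquely determined by $X$" means: whenever $X=\mathrm{Sub}(\gamma')\oplus S'$ with $\gamma'$ finite and $S'$ a sum-complete closed set, then $S'=S$. *)

theory Defs
  imports Main "HOL-Library.Sublist" "HOL-Combinatorics.Multiset_Permutations"
begin

(* The empty list, the permutation of length 0, is included. Without it Sub(gamma) \<oplus> S
   could not contain the permutation of length 1. *)
definition fin_perm :: "nat list \<Rightarrow> bool" where
  "fin_perm \<alpha> \<longleftrightarrow> \<alpha> \<in> permutations_of_set {1..length \<alpha>}"

definition order_iso :: "nat list \<Rightarrow> nat list \<Rightarrow> bool" where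
  "order_iso as bs \<longleftrightarrow> length as = length bs \<and>
     (\<forall>i<length as. \<forall>j<length as. as ! i < as ! j \<longleftrightarrow> bs ! i < bs ! j)"

definition involved :: "nat list \<Rightarrow> nat list \<Rightarrow> bool"  (infix "\<preceq>" 50) where
  "\<alpha> \<preceq> \<beta> \<longleftrightarrow> (\<exists>\<beta>'. subseq \<beta>' \<beta> \<and> order_iso \<alpha> \<beta>')"

definition closed_class :: "nat list set \<Rightarrow> bool" where
  "closed_class X \<longleftrightarrow> (\<forall>\<alpha>\<in>X. fin_perm \<alpha>) \<and>
     (\<forall>\<alpha>\<in>X. \<forall>\<delta>. fin_perm \<delta> \<and> \<delta> \<preceq> \<alpha> \<longrightarrow> \<delta> \<in> X)"

definition class_basis :: "nat list set \<Rightarrow> nat list set" where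
  "class_basis X = {\<beta>. fin_perm \<beta> \<and> \<beta> \<notin> X \<and>
     (\<forall>\<delta>. fin_perm \<delta> \<and> \<delta> \<preceq> \<beta> \<and> \<delta> \<noteq> \<beta> \<longrightarrow> \<delta> \<in> X)}"

definition finitely_based :: "nat list set \<Rightarrow> bool" where
  "finitely_based X \<longleftrightarrow> finite (class_basis X)"

definition Sub_fin :: "nat list \<Rightarrow> nat list set" where
  "Sub_fin \<gamma> = {\<sigma>. fin_perm \<sigma> \<and> \<sigma> \<preceq> \<gamma>}"

(* The positive integers are {1..} :: nat set; the value of a function at 0 is irrelevant. *)
definition pos_bij :: "(nat \<Rightarrow> nat) \<Rightarrow> bool" where
  "pos_bij \<pi> \<longleftrightarrow> bij_betw \<pi> {1..} {1..}"

definition Sub_inf :: "(nat \<Rightarrow> nat) \<Rightarrow> nat list set" where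
  "Sub_inf \<pi> = {\<sigma>. fin_perm \<sigma> \<and>
     (\<exists>cs. sorted_wrt (<) cs \<and> set cs \<subseteq> {1..} \<and> order_iso \<sigma> (map \<pi> cs))}"

definition natural_class :: "nat list set \<Rightarrow> bool" where
  "natural_class X \<longleftrightarrow> (\<exists>\<pi>. pos_bij \<pi> \<and> X = Sub_inf \<pi>)"

definition perm_sum :: "nat list \<Rightarrow> nat list \<Rightarrow> nat list"  (infixr "\<oplus>" 65) where
  "\<alpha> \<oplus> \<beta> = \<alpha> @ map (\<lambda>b. b + length \<alpha>) \<beta>"

definition class_sum :: "nat list set \<Rightarrow> nat list set \<Rightarrow> nat list set"  (infixr "\<oplus>\<^sub>C" 65) where
  "X \<oplus>\<^sub>C Y = {\<sigma> \<oplus> \<tau> | \<sigma> \<tau>. \<sigma> \<in> X \<and> \<tau> \<in> Y}"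

definition sum_complete :: "nat list set \<Rightarrow> bool" where
  "sum_complete X \<longleftrightarrow> (\<forall>\<alpha>\<in>X. \<forall>\<beta>\<in>X. \<alpha> \<oplus> \<beta> \<in> X)"

definition ultimately_periodic :: "(nat \<Rightarrow> nat) \<Rightarrow> bool" where
  "ultimately_periodic \<pi> \<longleftrightarrow>
     (\<exists>(N::int) (P::nat). P > 0 \<and> (\<forall>n\<ge>1. int n \<ge> N \<longrightarrow> \<pi> (n + P) = \<pi> n + P))"

end

theory Submission imports Defs begin

text \<open>
  Say that a pattern recurs in \<open>\<pi>\<close> if it occurs arbitrarily far out. If all basis elements have
  length at most \<open>b\<close>, a pattern occurs as soon as its subpatterns of length at most \<open>b\<close> do; hence every pattern
  of a sufficiently far tail of \<open>\<pi>\<close> recurs. If \<open>\<pi>\<close> has a sum decomposition after which everything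
  recurs, the class is \<open>Sub(\<gamma>) \<oplus> S\<close>, where \<open>S\<close> must consist of all \<open>\<sigma>\<close> such that \<open>\<tau> \<oplus> \<sigma>\<close> stays in the
  class for every \<open>\<tau>\<close> in it.

  Otherwise let \<open>c\<close> be the last place where \<open>\<pi>\<close> decomposes, so that some pattern \<open>C\<close> after \<open>c\<close> does not
  recur. Grow levels from \<open>c\<close> greedily: \<open>w\<^sub>k\<^sub>+\<^sub>1\<close> is the last position whose value does not exceed the
  maximum over the positions up to \<open>w\<^sub>k\<close>. An embedding of a large initial part of \<open>\<pi>\<close> cannot
  move \<open>C\<close> far out, so the images of all levels stay bounded; by compactness embeddings extend
  to all of \<open>\<pi>\<close>, and a nontrivial self-embedding could be iterated to make \<open>C\<close> recur. This gives
  rigidity, hence uniqueness of \<open>\<pi>\<close>.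

  For periodicity, splicing shows that a far level can be hung near the root without leaving the class,
  so the level sizes are bounded and two windows \<open>w\<^sub>k\<close>, \<open>w\<^sub>l\<close> look alike. Transplanting the tail at
  either one to the other stays in the class; comparing levels under the resulting
  embeddings, which are fixed at the root, shows that the transplants are order isomorphic to \<open>\<pi>\<close>.
\<close>

section \<open>Embeddings and patterns\<close>

text \<open>A pattern is a function together with a set of positions, so restricting, gluing or
  cutting out needs no renumbering. Only relative order counts.\<close>

definition emb :: "(nat \<Rightarrow> nat) \<Rightarrow> nat set \<Rightarrow> (nat \<Rightarrow> nat) \<Rightarrow> (nat \<Rightarrow> nat) \<Rightarrow> bool" where
  "emb p A q e \<longleftrightarrow>
     (\<forall>i\<in>A. \<forall>j\<in>A. (i < j \<longleftrightarrow> e i < e j) \<and> (p i < p j \<longleftrightarrow> q (e i) < q (e j)))"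

definition occurs :: "(nat \<Rightarrow> nat) \<Rightarrow> (nat \<Rightarrow> nat) \<Rightarrow> nat set \<Rightarrow> bool" where
  "occurs q p A \<longleftrightarrow> (\<exists>e. emb p A q e)"

text \<open>Only positions are required to go far out. For a bijection the values then grow as well,
  so copies lie above any given value too.\<close>

definition recurs :: "(nat \<Rightarrow> nat) \<Rightarrow> (nat \<Rightarrow> nat) \<Rightarrow> nat set \<Rightarrow> bool" where
  "recurs q p A \<longleftrightarrow> (\<forall>n. \<exists>e. emb p A q e \<and> (\<forall>i\<in>A. n \<le> e i))"

lemma embI:
  assumes "\<And>i j. i \<in> A \<Longrightarrow> j \<in> A \<Longrightarrow> i < j \<Longrightarrow> e i < e j"
    and "\<And>i j. i \<in> A \<Longrightarrow> j \<in> A \<Longrightarrow> p i < p j \<longleftrightarrow> q (e i) < q (e j)"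
  shows "emb p A q e"
  unfolding emb_def by (metis assms less_asym linorder_neqE_nat)

lemma emb_less: "emb p A q e \<Longrightarrow> i \<in> A \<Longrightarrow> j \<in> A \<Longrightarrow> e i < e j \<longleftrightarrow> i < j"
  by (simp add: emb_def)

lemma emb_le: "emb p A q e \<Longrightarrow> i \<in> A \<Longrightarrow> j \<in> A \<Longrightarrow> e i \<le> e j \<longleftrightarrow> i \<le> j"
  by (meson emb_less linorder_not_le)

lemma emb_val_less: "emb p A q e \<Longrightarrow> i \<in> A \<Longrightarrow> j \<in> A \<Longrightarrow> q (e i) < q (e j) \<longleftrightarrow> p i < p j"
  by (simp add: emb_def)

lemma emb_val_le: "emb p A q e \<Longrightarrow> i \<in> A \<Longrightarrow> j \<in> A \<Longrightarrow> q (e i) \<le> q (e j) \<longleftrightarrow> p i \<le> p j"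
  by (meson emb_val_less linorder_not_le)

lemma emb_subset: "emb p A q e \<Longrightarrow> B \<subseteq> A \<Longrightarrow> emb p B q e"
  by (auto simp: emb_def)

lemma emb_id: "emb p A p (\<lambda>i. i)"
  by (auto simp: emb_def)

lemma emb_comp: "emb p A q e \<Longrightarrow> emb q (e ` A) r f \<Longrightarrow> emb p A r (\<lambda>i. f (e i))"
  by (auto simp: emb_def)

lemma emb_comp_UNIV: "emb p A q e \<Longrightarrow> emb q UNIV r f \<Longrightarrow> emb p A r (\<lambda>i. f (e i))"
  by (auto simp: emb_def)

lemma emb_inj_on: "emb p A q e \<Longrightarrow> inj_on e A"
proof (rule inj_onI)
  fix i j assume "emb p A q e" "i \<in> A" "j \<in> A" "e i = e j"
  then show "i = j" using emb_le[of p A q e i j] emb_le[of p A q e j i] by simp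
qed

lemma emb_inv: "emb p A q e \<Longrightarrow> emb q (e ` A) p (the_inv_into A e)"
proof -
  assume e: "emb p A q e"
  note [simp] = the_inv_into_f_f[OF emb_inj_on[OF e]]
  show ?thesis using e by (auto simp: emb_def)
qed

lemma emb_increasing_atMost:
  assumes "emb p {..n} q e" "i \<le> n" shows "i \<le> e i"
  using assms(2)
proof (induction i)
  case (Suc i)
  then have "e i < e (Suc i)" using emb_less[OF assms(1), of i "Suc i"] by simp
  with Suc show ?case by simp
qed simp

lemma emb_increasing: "emb p UNIV q e \<Longrightarrow> i \<le> e i"
  by (rule emb_increasing_atMost[of p i q e i]) (auto elim: emb_subset)

lemma occurs_subset: "occurs q p A \<Longrightarrow> B \<subseteq> A \<Longrightarrow> occurs q p B"
  unfolding occurs_def using emb_subset by blast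

lemma occurs_self: "occurs p p A"
  unfolding occurs_def using emb_id by blast

lemma occurs_image: "emb p A q e \<Longrightarrow> occurs r q (e ` A) \<Longrightarrow> occurs r p A"
  unfolding occurs_def using emb_comp by blast

lemma recurs_image:
  assumes "emb p A q e" "recurs r q (e ` A)" shows "recurs r p A"
  unfolding recurs_def
proof
  fix n
  obtain f where "emb q (e ` A) r f" "\<forall>i\<in>e ` A. n \<le> f i"
    using assms(2) unfolding recurs_def by blast
  then show "\<exists>f. emb p A r f \<and> (\<forall>i\<in>A. n \<le> f i)"
    using emb_comp[OF assms(1)] by blast
qed

lemma recurs_subset: "recurs q p A \<Longrightarrow> B \<subseteq> A \<Longrightarrow> recurs q p B"
  unfolding recurs_def using emb_subset by (metis subsetD)

section \<open>Finite permutations as standardised patterns\<close>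

lemma fin_perm_iff: "fin_perm \<alpha> \<longleftrightarrow> distinct \<alpha> \<and> set \<alpha> = {1..length \<alpha>}"
  by (auto simp: fin_perm_def permutations_of_set_def)

lemma fin_perm_inj_on: "fin_perm \<alpha> \<Longrightarrow> inj_on ((!) \<alpha>) {..<length \<alpha>}"
  by (auto simp: fin_perm_iff inj_on_def nth_eq_iff_index_eq)

lemma fin_perm_nth: "fin_perm \<alpha> \<Longrightarrow> i < length \<alpha> \<Longrightarrow> 1 \<le> \<alpha> ! i \<and> \<alpha> ! i \<le> length \<alpha>"
  by (metis atLeastAtMost_iff fin_perm_iff nth_mem)

lemma finite_fin_perms: "finite {\<alpha>. fin_perm \<alpha> \<and> length \<alpha> \<le> n}"
proof (rule finite_subset)
  show "{\<alpha>. fin_perm \<alpha> \<and> length \<alpha> \<le> n} \<subseteq> {xs. set xs \<subseteq> {..n} \<and> length xs \<le> n}"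
    by (auto simp: fin_perm_iff)
qed (simp add: finite_lists_length_le)

lemma card_le_less_iff:
  fixes x y :: nat
  assumes "finite B" "x \<in> B" "y \<in> B"
  shows "card {z\<in>B. z \<le> x} < card {z\<in>B. z \<le> y} \<longleftrightarrow> x < y"
proof -
  have *: "card {z\<in>B. z \<le> x} < card {z\<in>B. z \<le> y}" if "x < y" "y \<in> B" for x y
  proof (rule psubset_card_mono)
    have "y \<in> {z\<in>B. z \<le> y}" "y \<notin> {z\<in>B. z \<le> x}" using that by auto
    moreover have "{z\<in>B. z \<le> x} \<subseteq> {z\<in>B. z \<le> y}" using that by auto
    ultimately show "{z\<in>B. z \<le> x} \<subset> {z\<in>B. z \<le> y}" by blast
  qed (use assms(1) in simp)
  show ?thesis
    using *[of x y] *[of y x] assms(2,3) by (cases x y rule: linorder_cases) auto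
qed

lemma finite_enumeration:
  fixes A :: "nat set"
  assumes "finite A"
  shows "\<exists>s. (\<forall>i<card A. \<forall>j<card A. i < j \<longleftrightarrow> s i < s j) \<and> s ` {..<card A} = A"
proof -
  define xs where "xs = sorted_list_of_set A"
  have xs: "sorted_wrt (<) xs" "set xs = A" "length xs = card A"
    using assms by (auto simp: xs_def)
  then have *: "xs ! i < xs ! j" if "i < j" "j < card A" for i j
    using that by (simp add: sorted_wrt_iff_nth_less)
  have "i < j \<longleftrightarrow> xs ! i < xs ! j" if "i < card A" "j < card A" for i j
    using *[of i j] *[of j i] that by (cases i j rule: linorder_cases) auto
  then have "\<forall>i<card A. \<forall>j<card A. i < j \<longleftrightarrow> xs ! i < xs ! j" by blast
  moreover have "(!) xs ` {..<card A} = A"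
    using xs by (metis list.set_map map_nth set_upt atLeast0LessThan)
  ultimately show ?thesis by blast
qed

text \<open>Standardisation: \<open>s\<close> lists the positions of \<open>A\<close> increasingly
  and \<open>r\<close> replaces each value by its rank. This leads from an arbitrary finite pattern
  to a permutation, hence to membership in the class.\<close>

lemma pattern_exists:
  assumes "finite A" "inj_on p A"
  shows "\<exists>\<sigma> s. fin_perm \<sigma> \<and> length \<sigma> = card A \<and> emb ((!) \<sigma>) {..<card A} p s \<and> s ` {..<card A} = A"
proof -
  obtain s where s: "\<forall>i<card A. \<forall>j<card A. i < j \<longleftrightarrow> s i < s j" "s ` {..<card A} = A"
    using finite_enumeration[OF assms(1)] by blast
  define r where "r = (\<lambda>x. card {z \<in> p ` A. z \<le> p x})"
  define \<sigma> where "\<sigma> = map (\<lambda>i. r (s i)) [0..<card A]"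
  have sA: "s i \<in> A" if "i < card A" for i using s(2) that by auto
  have s_inj: "inj_on s {..<card A}"
  proof (rule inj_onI)
    fix i j assume "i \<in> {..<card A}" "j \<in> {..<card A}" "s i = s j"
    then have "i < j \<longleftrightarrow> s i < s j" "j < i \<longleftrightarrow> s j < s i" using s(1) by blast+
    then show "i = j" using \<open>s i = s j\<close> by simp
  qed
  have r_less: "r x < r y \<longleftrightarrow> p x < p y" if "x \<in> A" "y \<in> A" for x y
    unfolding r_def by (rule card_le_less_iff) (use assms that in auto)
  have r_inj: "inj_on r A"
  proof (rule inj_onI)
    fix x y assume "x \<in> A" "y \<in> A" "r x = r y"
    then have "p x = p y" using r_less[of x y] r_less[of y x] by simp
    then show "x = y" using \<open>x \<in> A\<close> \<open>y \<in> A\<close> assms(2) by (simp add: inj_on_def)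
  qed
  have r_range: "r ` A \<subseteq> {1..card A}"
  proof
    fix y assume "y \<in> r ` A"
    then obtain x where x: "x \<in> A" "y = r x" by blast
    have "p x \<in> {z \<in> p ` A. z \<le> p x}" using x by simp
    moreover have "finite {z \<in> p ` A. z \<le> p x}" using assms(1) by simp
    ultimately have "r x > 0" unfolding r_def using card_gt_0_iff by blast
    moreover have "r x \<le> card (p ` A)" unfolding r_def using assms(1) by (intro card_mono) auto
    ultimately show "y \<in> {1..card A}" using card_image[OF assms(2)] x by auto
  qed
  have "card (r ` A) = card A" using r_inj by (rule card_image)
  then have rA: "r ` A = {1..card A}" using r_range by (intro card_subset_eq) auto
  have "set \<sigma> = r ` (s ` {..<card A})" by (auto simp: \<sigma>_def)
  moreover have "distinct \<sigma>" unfolding \<sigma>_def distinct_map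
    using comp_inj_on[OF s_inj] r_inj s(2) by (auto simp: comp_def atLeast0LessThan)
  ultimately have "fin_perm \<sigma>" using rA s(2) by (simp add: fin_perm_iff \<sigma>_def)
  moreover have "emb ((!) \<sigma>) {..<card A} p s"
    using s r_less sA by (auto simp: emb_def \<sigma>_def)
  ultimately show ?thesis using s(2) by (auto simp: \<sigma>_def)
qed

text \<open>Each entry of a permutation is one more than the number of smaller entries, which the
  relative order determines.\<close>

lemma order_iso_fin_perm_eq:
  assumes "fin_perm \<sigma>" "fin_perm \<tau>" "order_iso \<sigma> \<tau>"
  shows "\<sigma> = \<tau>"
proof -
  have *: "\<alpha> ! i = card {j. j < length \<alpha> \<and> \<alpha> ! j < \<alpha> ! i} + 1" if "fin_perm \<alpha>" "i < length \<alpha>" for \<alpha> i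
  proof -
    have "{1..<\<alpha> ! i} = (!) \<alpha> ` {j. j < length \<alpha> \<and> \<alpha> ! j < \<alpha> ! i}" (is "_ = _ ` ?J")
    proof
      show "{1..<\<alpha> ! i} \<subseteq> (!) \<alpha> ` ?J"
      proof
        fix y assume y: "y \<in> {1..<\<alpha> ! i}"
        then have "y \<in> set \<alpha>" using fin_perm_nth[OF that] that(1) by (simp add: fin_perm_iff)
        then show "y \<in> (!) \<alpha> ` ?J" using y by (auto simp: in_set_conv_nth image_iff)
      qed
    qed (use that fin_perm_nth in auto)
    then have "card {1..<\<alpha> ! i} = card ?J"
      using card_image[OF inj_on_subset[OF fin_perm_inj_on[OF that(1)], of ?J]] by auto
    then show ?thesis using fin_perm_nth[OF that] by simp linarith
  qed
  show ?thesis
  proof (rule nth_equalityI)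
    show "length \<sigma> = length \<tau>" using assms(3) by (simp add: order_iso_def)
    fix i assume i: "i < length \<sigma>"
    have "{j. j < length \<sigma> \<and> \<sigma> ! j < \<sigma> ! i} = {j. j < length \<tau> \<and> \<tau> ! j < \<tau> ! i}"
      using assms(3) i by (auto simp: order_iso_def)
    then show "\<sigma> ! i = \<tau> ! i" using *[OF assms(1) i] *[OF assms(2), of i] assms(3) i
      by (simp add: order_iso_def)
  qed
qed

section \<open>Involvement and membership in terms of embeddings\<close>

lemma subseq_index:
  "subseq xs ys \<Longrightarrow> \<exists>e. (\<forall>i<length xs. e i < length ys \<and> ys ! e i = xs ! i) \<and>
      (\<forall>i<length xs. \<forall>j<i. e j < e i)"
proof (induction xs ys rule: list_emb.induct)
  case (list_emb_Nil ys)
  then show ?case by simp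
next
  case (list_emb_Cons xs ys y)
  then obtain e where e: "\<forall>i<length xs. e i < length ys \<and> ys ! e i = xs ! i" "\<forall>i<length xs. \<forall>j<i. e j < e i"
    by blast
  show ?case by (rule exI[of _ "\<lambda>i. Suc (e i)"]) (use e in auto)
next
  case (list_emb_Cons2 x y xs ys)
  then obtain e where e: "\<forall>i<length xs. e i < length ys \<and> ys ! e i = xs ! i" "\<forall>i<length xs. \<forall>j<i. e j < e i"
    by blast
  show ?case
  proof (rule exI[of _ "\<lambda>i. case i of 0 \<Rightarrow> 0 | Suc i \<Rightarrow> Suc (e i)"], intro conjI allI impI)
    fix i assume i: "i < length (x # xs)"
    then show "(case i of 0 \<Rightarrow> 0 | Suc i \<Rightarrow> Suc (e i)) < length (y # ys)"
      "(y # ys) ! (case i of 0 \<Rightarrow> 0 | Suc i \<Rightarrow> Suc (e i)) = (x # xs) ! i"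
      using e list_emb_Cons2.hyps by (auto split: nat.split)
    fix j assume "j < i"
    then show "(case j of 0 \<Rightarrow> 0 | Suc i \<Rightarrow> Suc (e i)) < (case i of 0 \<Rightarrow> 0 | Suc i \<Rightarrow> Suc (e i))"
      using e i by (auto split: nat.split)
  qed
qed

lemma sorted_wrt_less_map_upt:
  "(\<forall>i<n. \<forall>j<n. i < j \<longrightarrow> e i < e j) \<Longrightarrow> sorted_wrt (<) (map e [0..<n])" for e :: "nat \<Rightarrow> nat"
  by (auto simp: sorted_wrt_iff_nth_less)

lemma index_subseq:
  assumes "\<forall>i<n. \<forall>j<n. i < j \<longrightarrow> e i < (e j :: nat)" "\<forall>i<n. e i < length ys"
  shows "subseq (map (\<lambda>i. ys ! e i) [0..<n]) ys"
proof -
  have "subseq (map e [0..<n]) [0..<length ys]"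
    by (rule sorted_subset_imp_subseq) (use assms in \<open>auto intro: strict_sorted_imp_sorted sorted_wrt_less_map_upt\<close>)
  then have "subseq (map ((!) ys) (map e [0..<n])) (map ((!) ys) [0..<length ys])"
    by (rule subseq_map)
  then show ?thesis by (simp add: map_nth comp_def)
qed

lemma involved_iff:
  "\<alpha> \<preceq> \<beta> \<longleftrightarrow> (\<exists>e. emb ((!) \<alpha>) {..<length \<alpha>} ((!) \<beta>) e \<and> e ` {..<length \<alpha>} \<subseteq> {..<length \<beta>})"
proof
  assume "\<alpha> \<preceq> \<beta>"
  then obtain \<beta>' where b: "subseq \<beta>' \<beta>" "order_iso \<alpha> \<beta>'" by (auto simp: involved_def)
  then obtain e where e: "\<forall>i<length \<alpha>. e i < length \<beta> \<and> \<beta> ! e i = \<beta>' ! i" "\<forall>i<length \<alpha>. \<forall>j<i. e j < e i"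
    using subseq_index[OF b(1)] by (auto simp: order_iso_def)
  have "emb ((!) \<alpha>) {..<length \<alpha>} ((!) \<beta>) e"
    by (rule embI) (use b e in \<open>auto simp: order_iso_def\<close>)
  then show "\<exists>e. emb ((!) \<alpha>) {..<length \<alpha>} ((!) \<beta>) e \<and> e ` {..<length \<alpha>} \<subseteq> {..<length \<beta>}"
    using e by auto
next
  assume "\<exists>e. emb ((!) \<alpha>) {..<length \<alpha>} ((!) \<beta>) e \<and> e ` {..<length \<alpha>} \<subseteq> {..<length \<beta>}"
  then obtain e where e: "emb ((!) \<alpha>) {..<length \<alpha>} ((!) \<beta>) e" "e ` {..<length \<alpha>} \<subseteq> {..<length \<beta>}"
    by blast
  have "subseq (map (\<lambda>i. \<beta> ! e i) [0..<length \<alpha>]) \<beta>"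
    by (rule index_subseq) (use e in \<open>auto simp: emb_def\<close>)
  moreover have "order_iso \<alpha> (map (\<lambda>i. \<beta> ! e i) [0..<length \<alpha>])"
    using e by (auto simp: order_iso_def emb_def)
  ultimately show "\<alpha> \<preceq> \<beta>" unfolding involved_def by blast
qed

lemma involved_trans: "\<alpha> \<preceq> \<beta> \<Longrightarrow> \<beta> \<preceq> \<gamma> \<Longrightarrow> \<alpha> \<preceq> \<gamma>"
proof -
  assume "\<alpha> \<preceq> \<beta>" "\<beta> \<preceq> \<gamma>"
  then obtain e f where ef:
    "emb ((!) \<alpha>) {..<length \<alpha>} ((!) \<beta>) e" "e ` {..<length \<alpha>} \<subseteq> {..<length \<beta>}"
    "emb ((!) \<beta>) {..<length \<beta>} ((!) \<gamma>) f" "f ` {..<length \<beta>} \<subseteq> {..<length \<gamma>}"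
    unfolding involved_iff by blast
  from emb_comp[OF ef(1) emb_subset[OF ef(3,2)]] ef(2,4) show ?thesis
    unfolding involved_iff by (intro exI[of _ "\<lambda>i. f (e i)"]) auto
qed
lemma involved_refl: "\<alpha> \<preceq> \<alpha>"
  unfolding involved_iff by (rule exI[of _ "\<lambda>i. i"]) (auto simp: emb_id)

lemma involved_length: "\<alpha> \<preceq> \<beta> \<Longrightarrow> length \<alpha> \<le> length \<beta>"
proof -
  assume "\<alpha> \<preceq> \<beta>"
  then obtain e where e: "emb ((!) \<alpha>) {..<length \<alpha>} ((!) \<beta>) e" "e ` {..<length \<alpha>} \<subseteq> {..<length \<beta>}"
    unfolding involved_iff by blast
  from card_mono[OF _ e(2)] card_image[OF emb_inj_on[OF e(1)]] show ?thesis by simp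
qed

lemma involved_same_length:
  assumes "\<alpha> \<preceq> \<beta>" "fin_perm \<alpha>" "fin_perm \<beta>" "length \<alpha> = length \<beta>" shows "\<alpha> = \<beta>"
  using assms by (metis involved_def order_iso_def order_iso_fin_perm_eq subseq_same_length)

text \<open>Bijections of the positive integers are handled as bijections of \<open>nat\<close>, by the shift
  \<open>n \<mapsto> \<pi> (n + 1) - 1\<close>.\<close>

lemma Sub_inf_iff:
  assumes "pos_bij \<pi>"
  shows "\<sigma> \<in> Sub_inf \<pi> \<longleftrightarrow> fin_perm \<sigma> \<and> occurs (\<lambda>n. \<pi> (Suc n) - 1) ((!) \<sigma>) {..<length \<sigma>}"
proof -
  have pos: "\<pi> (Suc n) \<ge> 1" for n using assms by (auto simp: pos_bij_def bij_betw_def)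
  \<comment> \<open>Truncated subtraction preserves strict order here because all values are at
    least 1.\<close>
  then have less: "\<pi> (Suc i) - 1 < \<pi> (Suc j) - 1 \<longleftrightarrow> \<pi> (Suc i) < \<pi> (Suc j)" for i j
    by (metis Suc_diff_1 Suc_le_eq Suc_less_eq One_nat_def)
  show ?thesis
  proof
    assume "\<sigma> \<in> Sub_inf \<pi>"
    then obtain cs where cs: "fin_perm \<sigma>" "sorted_wrt (<) cs" "set cs \<subseteq> {1..}" "order_iso \<sigma> (map \<pi> cs)"
      by (auto simp: Sub_inf_def)
    then have l: "length cs = length \<sigma>" by (simp add: order_iso_def)
    have 1: "cs ! i \<ge> 1" if "i < length \<sigma>" for i using cs(3) l that nth_mem[of i cs] by (metis atLeast_iff subsetD)
    then have S: "Suc (cs ! i - 1) = cs ! i" if "i < length \<sigma>" for i using that by (simp add: Suc_le_eq)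
    have "emb ((!) \<sigma>) {..<length \<sigma>} (\<lambda>n. \<pi> (Suc n) - 1) (\<lambda>i. cs ! i - 1)"
    proof (rule embI)
      fix i j assume ij: "i \<in> {..<length \<sigma>}" "j \<in> {..<length \<sigma>}"
      then show "\<sigma> ! i < \<sigma> ! j \<longleftrightarrow> \<pi> (Suc (cs ! i - 1)) - 1 < \<pi> (Suc (cs ! j - 1)) - 1"
        using cs(4) l S less[of "cs ! i - 1" "cs ! j - 1"] by (simp add: order_iso_def)
      assume "i < j"
      then have "cs ! i < cs ! j" using cs(2) ij l by (simp add: sorted_wrt_iff_nth_less)
      then show "cs ! i - 1 < cs ! j - 1" using 1[of i] 1[of j] ij by auto
    qed
    then show "fin_perm \<sigma> \<and> occurs (\<lambda>n. \<pi> (Suc n) - 1) ((!) \<sigma>) {..<length \<sigma>}"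
      using cs(1) by (auto simp: occurs_def)
  next
    assume "fin_perm \<sigma> \<and> occurs (\<lambda>n. \<pi> (Suc n) - 1) ((!) \<sigma>) {..<length \<sigma>}"
    then obtain e where e: "fin_perm \<sigma>" "emb ((!) \<sigma>) {..<length \<sigma>} (\<lambda>n. \<pi> (Suc n) - 1) e"
      by (auto simp: occurs_def)
    have "sorted_wrt (<) (map (\<lambda>i. Suc (e i)) [0..<length \<sigma>])"
      by (rule sorted_wrt_less_map_upt) (use e in \<open>auto simp: emb_def\<close>)
    moreover have "order_iso \<sigma> (map \<pi> (map (\<lambda>i. Suc (e i)) [0..<length \<sigma>]))"
      using e less by (auto simp: emb_def order_iso_def)
    ultimately show "\<sigma> \<in> Sub_inf \<pi>"
      using e(1) by (auto simp: Sub_inf_def intro!: exI[of _ "map (\<lambda>i. Suc (e i)) [0..<length \<sigma>]"])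
  qed
qed

section \<open>Closure and finite basis of Sub(\<pi>)\<close>

lemma bij_shift:
  assumes "pos_bij \<pi>" shows "bij (\<lambda>n. \<pi> (Suc n) - 1)"
proof -
  have "bij_betw Suc UNIV {1..}"
    by (rule bij_betwI[of _ _ _ "\<lambda>n. n - 1"]) auto
  moreover have "bij_betw (\<lambda>n. n - 1) {1..} (UNIV :: nat set)"
    by (rule bij_betwI[of _ _ _ Suc]) auto
  ultimately have "bij_betw ((\<lambda>n. n - 1) \<circ> (\<pi> \<circ> Suc)) UNIV UNIV"
    using assms unfolding pos_bij_def by (blast intro: bij_betw_trans)
  then show ?thesis by (simp add: comp_def)
qed

lemma closed_Sub_inf: assumes "pos_bij \<pi>" shows "closed_class (Sub_inf \<pi>)"
  unfolding closed_class_def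
proof (intro conjI ballI allI impI)
  fix \<alpha> assume a: "\<alpha> \<in> Sub_inf \<pi>"
  then show "fin_perm \<alpha>" by (simp add: Sub_inf_def)
  fix \<delta> assume d: "fin_perm \<delta> \<and> \<delta> \<preceq> \<alpha>"
  then obtain e where "emb ((!) \<delta>) {..<length \<delta>} ((!) \<alpha>) e" "e ` {..<length \<delta>} \<subseteq> {..<length \<alpha>}"
    by (auto simp: involved_iff)
  note e = this
  have "occurs (\<lambda>n. \<pi> (Suc n) - 1) ((!) \<alpha>) {..<length \<alpha>}"
    using a by (simp add: Sub_inf_iff[OF assms])
  from occurs_image[OF e(1) occurs_subset[OF this e(2)]]
  have "occurs (\<lambda>n. \<pi> (Suc n) - 1) ((!) \<delta>) {..<length \<delta>}" .
  then show "\<delta> \<in> Sub_inf \<pi>" using d by (simp add: Sub_inf_iff[OF assms])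
qed

text \<open>The form in which finiteness of the basis is used, \<open>b\<close> bounding the lengths
  of its elements. With \<open>p\<close> and \<open>A\<close> arbitrary it applies directly to
  glued, spliced and transplanted patterns.\<close>

definition bounded_basis :: "(nat \<Rightarrow> nat) \<Rightarrow> nat \<Rightarrow> bool" where
  "bounded_basis q b \<longleftrightarrow> (\<forall>p A. finite A \<and> inj_on p A \<and>
     (\<forall>Q\<subseteq>A. card Q \<le> b \<longrightarrow> occurs q p Q) \<longrightarrow> occurs q p A)"

text \<open>A pattern outside the class contains a basis element, and the at most \<open>b\<close>
  positions occupied by it already fail to occur.\<close>

lemma bounded_basis_exists:
  assumes "pos_bij \<pi>" "finitely_based (Sub_inf \<pi>)"
  shows "\<exists>b. bounded_basis (\<lambda>n. \<pi> (Suc n) - 1) b"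
proof -
  let ?q = "\<lambda>n. \<pi> (Suc n) - 1"
  obtain b where b: "\<And>\<beta>. \<beta> \<in> class_basis (Sub_inf \<pi>) \<Longrightarrow> length \<beta> \<le> b"
    using assms(2) finite_imageI[of _ length] unfolding finitely_based_def
    by (meson finite_nat_set_iff_bounded_le image_eqI)
  have "occurs ?q p A" if A: "finite A" "inj_on p A" "\<forall>Q\<subseteq>A. card Q \<le> b \<longrightarrow> occurs ?q p Q" for p A
  proof -
    obtain \<sigma> s where s: "fin_perm \<sigma>" "length \<sigma> = card A" "emb ((!) \<sigma>) {..<card A} p s" "s ` {..<card A} = A"
      using pattern_exists[OF A(1,2)] by blast
    have "\<sigma> \<in> Sub_inf \<pi>"
    proof (rule ccontr)
      assume "\<sigma> \<notin> Sub_inf \<pi>"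
      then have "\<exists>\<delta>. fin_perm \<delta> \<and> \<delta> \<preceq> \<sigma> \<and> \<delta> \<notin> Sub_inf \<pi>" using s(1) involved_refl by blast
      \<comment> \<open>A non-member of least length inside \<open>\<sigma>\<close>; proper involved
        permutations are shorter, so it is a basis element.\<close>
      then obtain \<beta> where \<beta>: "fin_perm \<beta>" "\<beta> \<preceq> \<sigma>" "\<beta> \<notin> Sub_inf \<pi>"
        and min: "\<And>\<delta>. length \<delta> < length \<beta> \<Longrightarrow> \<not> (fin_perm \<delta> \<and> \<delta> \<preceq> \<sigma> \<and> \<delta> \<notin> Sub_inf \<pi>)"
        using exists_least_iff[of "\<lambda>n. \<exists>\<delta>. length \<delta> = n \<and> fin_perm \<delta> \<and> \<delta> \<preceq> \<sigma> \<and> \<delta> \<notin> Sub_inf \<pi>"] by blast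
      have "\<beta> \<in> class_basis (Sub_inf \<pi>)"
        unfolding class_basis_def
      proof (intro CollectI conjI allI impI)
        fix \<delta> assume d: "fin_perm \<delta> \<and> \<delta> \<preceq> \<beta> \<and> \<delta> \<noteq> \<beta>"
        then have "length \<delta> < length \<beta>"
          using \<beta>(1) involved_length involved_same_length le_neq_implies_less by blast
        moreover have "\<delta> \<preceq> \<sigma>" using d \<beta>(2) involved_trans by blast
        ultimately show "\<delta> \<in> Sub_inf \<pi>" using min d by blast
      qed (use \<beta> in auto)
      then have len: "length \<beta> \<le> b" by (rule b)
      obtain e where e: "emb ((!) \<beta>) {..<length \<beta>} ((!) \<sigma>) e" "e ` {..<length \<beta>} \<subseteq> {..<card A}"
        using \<beta>(2) s(2) by (auto simp: involved_iff)
      have se: "emb ((!) \<beta>) {..<length \<beta>} p (\<lambda>i. s (e i))"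
        using emb_comp[OF e(1) emb_subset[OF s(3) e(2)]] .
      have "card ((\<lambda>i. s (e i)) ` {..<length \<beta>}) = length \<beta>"
        using card_image[OF emb_inj_on[OF se]] by simp
      moreover have "(\<lambda>i. s (e i)) ` {..<length \<beta>} \<subseteq> A" using e(2) s(4) by auto
      ultimately have "occurs ?q p ((\<lambda>i. s (e i)) ` {..<length \<beta>})" using A(3) len by simp
      then have "\<beta> \<in> Sub_inf \<pi>" using occurs_image[OF se] \<beta>(1) assms(1) by (simp add: Sub_inf_iff)
      with \<beta>(3) show False ..
    qed
    then have "occurs ?q ((!) \<sigma>) {..<card A}" using assms(1) s(2) by (simp add: Sub_inf_iff)
    then show ?thesis
      using occurs_image[OF emb_inv[OF s(3)]] the_inv_into_onto[OF emb_inj_on[OF s(3)]] s(4) by simp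
  qed
  then show ?thesis unfolding bounded_basis_def by blast
qed

text \<open>Both sides are membership of the standardised pattern, so occurrence of finite patterns
  depends on the class alone.\<close>

lemma occurs_transfer:
  assumes "pos_bij \<pi>" "pos_bij \<pi>'" "Sub_inf \<pi> = Sub_inf \<pi>'" "finite A" "inj_on p A"
  shows "occurs (\<lambda>n. \<pi> (Suc n) - 1) p A \<longleftrightarrow> occurs (\<lambda>n. \<pi>' (Suc n) - 1) p A"
proof -
  obtain \<sigma> s where s: "fin_perm \<sigma>" "length \<sigma> = card A" "emb ((!) \<sigma>) {..<card A} p s" "s ` {..<card A} = A"
    using pattern_exists[OF assms(4,5)] by blast
  have inv: "emb p A ((!) \<sigma>) (the_inv_into {..<card A} s)" "the_inv_into {..<card A} s ` A = {..<card A}"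
    using emb_inv[OF s(3)] the_inv_into_onto[OF emb_inj_on[OF s(3)]] s(4) by simp_all
  have *: "occurs q p A \<longleftrightarrow> occurs q ((!) \<sigma>) {..<card A}" for q
    using occurs_image[OF s(3), of q] occurs_image[OF inv(1), of q] s(4) inv(2) by auto
  show ?thesis unfolding *
    using Sub_inf_iff[OF assms(1), of \<sigma>] Sub_inf_iff[OF assms(2), of \<sigma>] assms(3) s(1,2) by simp
qed

section \<open>Recurrence\<close>

text \<open>The direct sum of the first \<open>n\<close> entries of \<open>q\<close> with the
  pattern \<open>p\<close>; adding up these entries gives a crude bound that lifts \<open>p\<close>
  above all of them.\<close>

definition glue :: "(nat \<Rightarrow> nat) \<Rightarrow> nat \<Rightarrow> (nat \<Rightarrow> nat) \<Rightarrow> nat \<Rightarrow> nat" where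
  "glue q n p i = (if i < n then q i else p (i - n) + Suc (\<Sum>j<n. q j))"

abbreviation glue_dom :: "nat \<Rightarrow> nat set \<Rightarrow> nat set" where
  "glue_dom n A \<equiv> {..<n} \<union> (\<lambda>i. i + n) ` A"

lemma glue_less: "i < n \<Longrightarrow> n \<le> j \<Longrightarrow> glue q n p i < glue q n p j"
  using member_le_sum[of i "{..<n}" q] by (auto simp: glue_def)

lemma glue_shift_emb: "emb p A (glue q n p) (\<lambda>i. i + n)"
  by (auto simp: emb_def glue_def)

lemma glue_unshift_emb: "B \<subseteq> {n..} \<Longrightarrow> emb (glue q n p) B p (\<lambda>i. i - n)"
  by (rule embI) (auto simp: glue_def)

lemma glue_initial_emb: "B \<subseteq> {..<n} \<Longrightarrow> emb (glue q n p) B q (\<lambda>i. i)"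
  by (rule embI) (auto simp: glue_def subset_iff)

lemma glue_inj_on:
  assumes "inj q" "inj_on p A" shows "inj_on (glue q n p) (glue_dom n A)"
proof -
  have "inj_on (glue q n p) {..<n}" using assms(1) by (auto simp: inj_on_def glue_def)
  moreover have "inj_on (glue q n p) ((\<lambda>i. i + n) ` A)"
    using assms(2) by (auto simp: inj_on_def glue_def)
  moreover have "glue q n p i \<noteq> glue q n p (j + n)" if "i < n" for i j
    using glue_less[OF that, of "j + n" q p] by simp
  ultimately show ?thesis by (auto simp: inj_on_Un)
qed

text \<open>For positive \<open>n\<close>, position \<open>n - 1\<close> is sent to at least
  \<open>n - 1\<close>, so the \<open>A\<close>-part of a glued copy lies at positions from
  \<open>n\<close> on. This turns recurrence into plain occurrence, which the basis can
  test.\<close>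

lemma recursI_glue:
  assumes "\<And>n. occurs r (glue q n p) (glue_dom n A)"
  shows "recurs r p A"
  unfolding recurs_def
proof
  fix n
  obtain e where e: "emb (glue q n p) (glue_dom n A) r e"
    using assms[of n] by (auto simp: occurs_def)
  have "n \<le> e (i + n)" if i: "i \<in> A" for i
  proof (cases n)
    case (Suc m)
    have "{..m} \<subseteq> glue_dom n A" by (auto simp: Suc)
    with emb_increasing_atMost[OF emb_subset[OF e], of m m] have "m \<le> e m" by simp
    also have "e m < e (i + n)" using emb_less[OF e, of m "i + n"] i Suc by auto
    finally show ?thesis using Suc by simp
  qed simp
  moreover have "emb p A r (\<lambda>i. e (i + n))"
    by (rule emb_comp[OF glue_shift_emb[of p A q n] emb_subset[OF e]]) auto
  ultimately show "\<exists>e. emb p A r e \<and> (\<forall>i\<in>A. n \<le> e i)" by blast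
qed

section \<open>Placing recurring patterns above and to the right\<close>

locale nat_perm =
  fixes \<pi> :: "nat \<Rightarrow> nat"
  assumes bij: "bij \<pi>"
begin

lemma inj: "inj \<pi>" using bij by (rule bij_is_inj)

lemma inj_on: "inj_on \<pi> A" using inj by (rule inj_on_subset) simp

lemma eq_iff [simp]: "\<pi> i = \<pi> j \<longleftrightarrow> i = j" using inj by (rule inj_eq)

lemma surj_ex: "\<exists>i. \<pi> i = v" using bij by (metis bij_pointE)

lemma finite_le: "finite {i. \<pi> i \<le> v}"
proof -
  have "{i. \<pi> i \<le> v} = \<pi> -` {..v}" by auto
  then show ?thesis by (simp add: finite_vimageI inj)
qed

lemma eventually_above: "\<exists>N. \<forall>n\<ge>N. v < \<pi> n"
proof -
  obtain N where "\<forall>i\<in>{i. \<pi> i \<le> v}. i < N" using finite_le finite_nat_set_iff_bounded by blast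
  then show ?thesis by (metis linorder_not_le mem_Collect_eq)
qed

text \<open>Beyond some \<open>N\<close> every value exceeds those used by the copy of the finite
  set \<open>A\<close>, so a copy of \<open>B\<close> far enough out lies above and to the right of
  it.\<close>

lemma join:
  assumes "emb p A \<pi> e" "finite A" "recurs \<pi> p B"
    and "\<And>i j. i \<in> A \<Longrightarrow> j \<in> B \<Longrightarrow> i < j \<and> p i < p j"
  shows "\<exists>f. emb p (A \<union> B) \<pi> f \<and> (\<forall>i\<in>A. f i = e i) \<and> (\<forall>i\<in>B. n \<le> f i)"
proof -
  obtain V where V: "\<forall>i\<in>A. e i < V \<and> \<pi> (e i) < V"
  proof -
    have "finite (e ` A \<union> (\<lambda>i. \<pi> (e i)) ` A)" using assms(2) by simp
    then show ?thesis using that unfolding finite_nat_set_iff_bounded by blast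
  qed
  obtain N where N: "\<forall>n\<ge>N. V < \<pi> n" using eventually_above by blast
  obtain g where g: "emb p B \<pi> g" "\<forall>i\<in>B. n + N + V \<le> g i"
    using assms(3) unfolding recurs_def by blast
  define f where "f i = (if i \<in> A then e i else g i)" for i
  have disj: "i \<notin> A" if "i \<in> B" for i using assms(4)[OF _ that] by blast
  have AB: "f i < f j \<and> \<pi> (f i) < \<pi> (f j)" if "i \<in> A" "j \<in> B" for i j
  proof -
    have "V \<le> g j" "N \<le> g j" using g(2) that by (meson add_leE)+
    moreover have "e i < V" "\<pi> (e i) < V" using V that by auto
    ultimately show ?thesis using N that disj by (auto simp: f_def intro: less_trans)
  qed
  have "emb p (A \<union> B) \<pi> f"
  proof (rule embI)
    fix i j assume ij: "i \<in> A \<union> B" "j \<in> A \<union> B"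
    show "f i < f j" if "i < j"
      using ij that AB[of i j] assms(4)[of j i] emb_less[OF assms(1)] emb_less[OF g(1)] disj
      by (auto simp: f_def)
    show "p i < p j \<longleftrightarrow> \<pi> (f i) < \<pi> (f j)"
      using ij AB[of i j] AB[of j i] assms(4)[of i j] assms(4)[of j i]
        emb_val_less[OF assms(1)] emb_val_less[OF g(1)] disj
      by (auto simp: f_def)
  qed
  moreover have "\<forall>i\<in>B. n \<le> f i" using g(2) disj by (auto simp: f_def intro: add_leE)
  ultimately show ?thesis by (auto simp: f_def)
qed

lemma occurs_join:
  assumes "occurs \<pi> p A" "finite A" "recurs \<pi> p B"
    and "\<And>i j. i \<in> A \<Longrightarrow> j \<in> B \<Longrightarrow> i < j \<and> p i < p j"
  shows "occurs \<pi> p (A \<union> B)"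
  using join[OF _ assms(2-4)] assms(1) unfolding occurs_def by blast

lemma occurs_glue:
  assumes "occurs \<pi> q {..<n}" "recurs \<pi> p A"
  shows "occurs \<pi> (glue q n p) (glue_dom n A)"
proof (rule occurs_join)
  show "occurs \<pi> (glue q n p) {..<n}"
    using occurs_image[OF glue_initial_emb[of "{..<n}" n q p]] assms(1) by simp
  have "recurs \<pi> p ((\<lambda>i. i - n) ` (\<lambda>i. i + n) ` A)" using assms(2) by (simp add: image_image)
  then show "recurs \<pi> (glue q n p) ((\<lambda>i. i + n) ` A)"
    by (rule recurs_image[OF glue_unshift_emb, rotated]) auto
qed (auto intro: glue_less)

end

text \<open>By gluing, a finite pattern recurs exactly when its sum with every initial segment of
  \<open>\<pi>\<close> occurs, and that is decided by the class.\<close>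

lemma recurs_transfer:
  assumes "nat_perm \<pi>" "nat_perm \<pi>'"
    and same: "\<And>p A. finite A \<Longrightarrow> inj_on p A \<Longrightarrow> occurs \<pi> p A = occurs \<pi>' p A"
    and "recurs \<pi>' p A" "finite A" "inj_on p A"
  shows "recurs \<pi> p A"
proof (rule recursI_glue[where q = \<pi>])
  fix n
  have inj: "inj \<pi>" using assms(1) by (rule nat_perm.inj)
  have "occurs \<pi>' \<pi> {..<n}" using same[of "{..<n}" \<pi>] occurs_self inj by (simp add: inj_on_def)
  then have "occurs \<pi>' (glue \<pi> n p) (glue_dom n A)"
    by (rule nat_perm.occurs_glue[OF assms(2) _ assms(4)])
  then show "occurs \<pi> (glue \<pi> n p) (glue_dom n A)"
    using same[of "glue_dom n A" "glue \<pi> n p"] glue_inj_on[OF inj assms(6)] assms(5) by simp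
qed

section \<open>Recurrence of the tail under a bounded basis\<close>

locale based_perm = nat_perm +
  fixes b :: nat
  assumes basis: "bounded_basis \<pi> b"
begin

lemma occursI:
  assumes "finite A" "inj_on p A"
    and "\<And>Q. Q \<subseteq> A \<Longrightarrow> finite Q \<Longrightarrow> card Q \<le> b \<Longrightarrow> occurs \<pi> p Q"
  shows "occurs \<pi> p A"
proof -
  have "\<forall>Q\<subseteq>A. card Q \<le> b \<longrightarrow> occurs \<pi> p Q" using assms finite_subset by blast
  then show ?thesis
    using basis[unfolded bounded_basis_def, rule_format, of A p] assms(1,2) by blast
qed

text \<open>Only finitely many patterns have length at most \<open>b\<close>, so beyond some
  \<open>n0\<close> no non-recurring one among them occurs. A longer pattern of that tail recurs
  because its sums with initial segments pass the test on subsets of size at most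
  \<open>b\<close>.\<close>

lemma eventually_recurs: "\<exists>n0. \<forall>A. finite A \<and> A \<subseteq> {n0..} \<longrightarrow> recurs \<pi> \<pi> A"
proof -
  let ?B = "{\<sigma>. fin_perm \<sigma> \<and> length \<sigma> \<le> b}"
  let ?bad = "\<lambda>\<sigma> n. \<forall>e. emb ((!) \<sigma>) {..<length \<sigma>} \<pi> e \<longrightarrow> \<not> (\<forall>i<length \<sigma>. n \<le> e i)"
  have "\<exists>n. \<not> recurs \<pi> ((!) \<sigma>) {..<length \<sigma>} \<longrightarrow> ?bad \<sigma> n" for \<sigma>
    unfolding recurs_def by (simp add: Ball_def)
  then obtain N where N: "\<And>\<sigma>. \<not> recurs \<pi> ((!) \<sigma>) {..<length \<sigma>} \<Longrightarrow> ?bad \<sigma> (N \<sigma>)" by metis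
  \<comment> \<open>The sum serves as a common upper bound of the finitely many
    \<open>N \<sigma>\<close>.\<close>
  define n0 where "n0 = (\<Sum>\<sigma>\<in>?B. N \<sigma>)"
  have small: "recurs \<pi> \<pi> A" if A: "A \<subseteq> {n0..}" "finite A" "card A \<le> b" for A
  proof -
    obtain \<sigma> s where s: "fin_perm \<sigma>" "length \<sigma> = card A" "emb ((!) \<sigma>) {..<card A} \<pi> s" "s ` {..<card A} = A"
      using pattern_exists[OF A(2) inj_on] by blast
    have "N \<sigma> \<le> n0" unfolding n0_def using s A finite_fin_perms by (intro member_le_sum) auto
    then have "\<forall>i<length \<sigma>. N \<sigma> \<le> s i" using s A(1) by (metis atLeast_iff dual_order.trans imageI lessThan_iff subsetD)
    then have "recurs \<pi> ((!) \<sigma>) {..<card A}" using N s by metis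
    then show ?thesis
      using recurs_image[OF emb_inv[OF s(3)]] the_inv_into_onto[OF emb_inj_on[OF s(3)]] s(4) by simp
  qed
  have "recurs \<pi> \<pi> A" if A: "finite A" "A \<subseteq> {n0..}" for A
  proof (rule recursI_glue[where q = \<pi>], rule occursI)
    fix n Q assume Q: "Q \<subseteq> glue_dom n A" "finite Q" "card Q \<le> b"
    let ?Q = "Q \<inter> {n..}"
    have "recurs \<pi> \<pi> ((\<lambda>i. i - n) ` ?Q)"
    proof (rule small)
      have "?Q \<subseteq> (\<lambda>i. i + n) ` A" using Q(1) by auto
      then have "(\<lambda>i. i - n) ` ?Q \<subseteq> (\<lambda>i. i - n) ` (\<lambda>i. i + n) ` A" by (rule image_mono)
      then show "(\<lambda>i. i - n) ` ?Q \<subseteq> {n0..}" using A(2) by (simp add: image_image)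
      have "card ((\<lambda>i. i - n) ` ?Q) \<le> card ?Q" using Q(2) by (intro card_image_le) simp
      also have "\<dots> \<le> card Q" using Q(2) by (intro card_mono) auto
      finally show "card ((\<lambda>i. i - n) ` ?Q) \<le> b" using Q(3) by simp
    qed (use Q(2) in simp)
    then have 2: "recurs \<pi> (glue \<pi> n \<pi>) ?Q" by (rule recurs_image[OF glue_unshift_emb, rotated]) auto
    \<comment> \<open>The points of \<open>Q\<close> in the initial segment occur as they stand; the
      others recur by \<open>small\<close> and can be joined to them.\<close>
    have 1: "occurs \<pi> (glue \<pi> n \<pi>) (Q \<inter> {..<n})"
      using glue_initial_emb unfolding occurs_def by blast
    have "occurs \<pi> (glue \<pi> n \<pi>) (Q \<inter> {..<n} \<union> ?Q)"
      by (rule occurs_join[OF 1 _ 2]) (use Q(2) in \<open>auto intro: glue_less\<close>)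
    moreover have "Q \<inter> {..<n} \<union> ?Q = Q" by auto
    ultimately show "occurs \<pi> (glue \<pi> n \<pi>) Q" by simp
  qed (use A inj inj_on in \<open>auto intro!: glue_inj_on\<close>)
  then show ?thesis by blast
qed

end

section \<open>Sum decompositions\<close>

lemma length_perm_sum [simp]: "length (\<alpha> \<oplus> \<beta>) = length \<alpha> + length \<beta>"
  by (simp add: perm_sum_def)

lemma nth_perm_sum:
  "i < length \<alpha> + length \<beta> \<Longrightarrow>
   (\<alpha> \<oplus> \<beta>) ! i = (if i < length \<alpha> then \<alpha> ! i else \<beta> ! (i - length \<alpha>) + length \<alpha>)"
  by (auto simp: perm_sum_def nth_append)

lemma perm_sum_assoc: "(\<alpha> \<oplus> \<beta>) \<oplus> \<gamma> = \<alpha> \<oplus> (\<beta> \<oplus> \<gamma>)"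
  by (auto simp: perm_sum_def)

lemma fin_perm_perm_sum:
  assumes "fin_perm \<alpha>" "fin_perm \<beta>" shows "fin_perm (\<alpha> \<oplus> \<beta>)"
proof -
  let ?f = "\<lambda>b. b + length \<alpha>"
  have a: "distinct \<alpha>" "set \<alpha> = {1..length \<alpha>}" and b: "distinct \<beta>" "set \<beta> = {1..length \<beta>}"
    using assms by (auto simp: fin_perm_iff)
  have im: "?f ` {1..length \<beta>} = {1 + length \<alpha>..length \<beta> + length \<alpha>}" by (rule image_add_atLeastAtMost')
  have "distinct (\<alpha> \<oplus> \<beta>)" using a b by (auto simp: perm_sum_def distinct_map inj_on_def)
  moreover have "set (\<alpha> \<oplus> \<beta>) = {1..length \<alpha>} \<union> {1 + length \<alpha>..length \<beta> + length \<alpha>}"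
    using a b im by (simp add: perm_sum_def)
  moreover have "\<dots> = {1..length (\<alpha> \<oplus> \<beta>)}" by auto
  ultimately show ?thesis by (simp add: fin_perm_iff)
qed

lemma emb_perm_sum_left: "emb ((!) \<alpha>) {..<length \<alpha>} ((!) (\<alpha> \<oplus> \<beta>)) (\<lambda>i. i)"
  by (rule embI) (auto simp: nth_perm_sum)

lemma emb_perm_sum_right: "emb ((!) \<beta>) {..<length \<beta>} ((!) (\<alpha> \<oplus> \<beta>)) (\<lambda>i. i + length \<alpha>)"
  by (rule embI) (auto simp: nth_perm_sum)

lemma involved_perm_sum_mono:
  assumes "\<delta> \<preceq> \<beta>" "fin_perm \<alpha>" "fin_perm \<delta>" "fin_perm \<beta>"
  shows "\<alpha> \<oplus> \<delta> \<preceq> \<alpha> \<oplus> \<beta>"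
proof -
  let ?n = "length \<alpha>"
  obtain e where e: "emb ((!) \<delta>) {..<length \<delta>} ((!) \<beta>) e" "e ` {..<length \<delta>} \<subseteq> {..<length \<beta>}"
    using assms(1) unfolding involved_iff by blast
  define f where "f i = (if i < ?n then i else e (i - ?n) + ?n)" for i
  have ek: "e (i - ?n) < length \<beta>" "i - ?n < length \<delta>" if "i < ?n + length \<delta>" "\<not> i < ?n" for i
  proof -
    show "i - ?n < length \<delta>" using that by simp
    then show "e (i - ?n) < length \<beta>" using e(2) by blast
  qed
  have "emb ((!) (\<alpha> \<oplus> \<delta>)) {..<length (\<alpha> \<oplus> \<delta>)} ((!) (\<alpha> \<oplus> \<beta>)) f"
  proof (rule embI)
    fix i j assume "i \<in> {..<length (\<alpha> \<oplus> \<delta>)}" "j \<in> {..<length (\<alpha> \<oplus> \<delta>)}"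
    then have ij: "i < ?n + length \<delta>" "j < ?n + length \<delta>" by simp_all
    show "f i < f j" if "i < j"
      using that ij ek[of i] ek[of j] emb_less[OF e(1), of "i - ?n" "j - ?n"] by (auto simp: f_def)
    consider "i < ?n" "j < ?n" | "i < ?n" "\<not> j < ?n" | "\<not> i < ?n" "j < ?n" | "\<not> i < ?n" "\<not> j < ?n"
      by blast
    then show "(\<alpha> \<oplus> \<delta>) ! i < (\<alpha> \<oplus> \<delta>) ! j \<longleftrightarrow> (\<alpha> \<oplus> \<beta>) ! f i < (\<alpha> \<oplus> \<beta>) ! f j"
    proof cases
      case 2
      then show ?thesis
        using ij ek[of j] fin_perm_nth[OF assms(2), of i] fin_perm_nth[OF assms(3), of "j - ?n"]
          fin_perm_nth[OF assms(4), of "e (j - ?n)"]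
        by (auto simp: f_def nth_perm_sum)
    next
      case 3
      then show ?thesis
        using ij ek[of i] fin_perm_nth[OF assms(2), of j] fin_perm_nth[OF assms(3), of "i - ?n"]
          fin_perm_nth[OF assms(4), of "e (i - ?n)"]
        by (auto simp: f_def nth_perm_sum)
    next
      case 4
      then show ?thesis
        using ij ek[of i] ek[of j] emb_val_less[OF e(1), of "i - ?n" "j - ?n"]
        by (auto simp: f_def nth_perm_sum)
    qed (auto simp: f_def nth_perm_sum)
  qed
  moreover have "f ` {..<length (\<alpha> \<oplus> \<delta>)} \<subseteq> {..<length (\<alpha> \<oplus> \<beta>)}"
    using ek by (auto simp: f_def)
  ultimately show ?thesis unfolding involved_iff by blast
qed

text \<open>The first \<open>m\<close> entries form a downward closed subset of
  \<open>{1..length \<sigma>}\<close>, hence are \<open>{1..m}\<close>; lowering the rest by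
  \<open>m\<close> gives the second summand.\<close>

lemma fin_perm_split:
  assumes "fin_perm \<sigma>" "m \<le> length \<sigma>"
    and less: "\<And>i j. i < m \<Longrightarrow> m \<le> j \<Longrightarrow> j < length \<sigma> \<Longrightarrow> \<sigma> ! i < \<sigma> ! j"
  shows "\<exists>\<alpha> \<beta>. fin_perm \<alpha> \<and> fin_perm \<beta> \<and> \<sigma> = \<alpha> \<oplus> \<beta> \<and> length \<alpha> = m"
proof -
  let ?\<alpha> = "take m \<sigma>" and ?d = "drop m \<sigma>" and ?n = "length \<sigma>"
  have \<sigma>: "distinct \<sigma>" "set ?\<alpha> \<union> set ?d = {1..?n}"
    using assms(1) by (simp_all add: fin_perm_iff set_append[symmetric] del: set_append)
  have lt: "x < y" if "x \<in> set ?\<alpha>" "y \<in> set ?d" for x y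
    using that less assms(2) by (auto simp: in_set_conv_nth)
  have card: "card (set ?\<alpha>) = m" using \<sigma>(1) assms(2) by (simp add: distinct_card)
  have "set ?\<alpha> \<subseteq> {1..m}"
  proof
    fix y assume y: "y \<in> set ?\<alpha>"
    have y1: "1 \<le> y" "y \<le> ?n" using \<sigma>(2) y by auto
    have "{1..y} \<subseteq> set ?\<alpha>"
    proof
      fix z assume z: "z \<in> {1..y}"
      then have "z \<in> set ?\<alpha> \<union> set ?d" using \<sigma>(2) y1 by auto
      then show "z \<in> set ?\<alpha>" using lt[OF y, of z] z by auto
    qed
    then have "card {1..y} \<le> m" using card_mono[of "set ?\<alpha>" "{1..y}"] card by simp
    then show "y \<in> {1..m}" using y1 by simp
  qed
  then have a: "set ?\<alpha> = {1..m}" using card by (intro card_subset_eq) auto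
  have disj: "set ?\<alpha> \<inter> set ?d = {}" using \<sigma>(1) by (rule set_take_disj_set_drop_if_distinct) simp
  have d: "set ?d = {m + 1..?n}"
  proof -
    have "set ?d = {1..?n} - {1..m}" using \<sigma>(2) disj a by blast
    also have "\<dots> = {m + 1..?n}" by auto
    finally show ?thesis .
  qed
  let ?\<beta> = "map (\<lambda>x. x - m) ?d"
  have "(\<lambda>x. x - m) ` {m + 1..?n} = {1..?n - m}"
  proof
    show "{1..?n - m} \<subseteq> (\<lambda>x. x - m) ` {m + 1..?n}"
    proof
      fix y assume "y \<in> {1..?n - m}"
      then have "y = (y + m) - m" "y + m \<in> {m + 1..?n}" by auto
      then show "y \<in> (\<lambda>x. x - m) ` {m + 1..?n}" by blast
    qed
  qed auto
  moreover have "inj_on (\<lambda>x. x - m) (set ?d)" unfolding d by (auto simp: inj_on_def)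
  ultimately have "fin_perm ?\<beta>" using \<sigma>(1) d by (simp add: fin_perm_iff distinct_map)
  moreover have "fin_perm ?\<alpha>" using \<sigma>(1) a assms(2) by (simp add: fin_perm_iff)
  moreover have "map (\<lambda>x. x - m + m) ?d = ?d" by (rule map_idI) (use d in auto)
  then have "\<sigma> = ?\<alpha> \<oplus> ?\<beta>" using assms(2) by (simp add: perm_sum_def comp_def)
  ultimately show ?thesis using assms(2) by (metis length_take min.absorb2)
qed

text \<open>The only possible summand, defined from the class alone, so that uniqueness amounts to
  \<open>S = sum_stabilizer X\<close>.\<close>

definition sum_stabilizer :: "nat list set \<Rightarrow> nat list set" where
  "sum_stabilizer X = {\<sigma>. fin_perm \<sigma> \<and> (\<forall>\<tau>\<in>X. \<tau> \<oplus> \<sigma> \<in> X)}"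

lemma sum_complete_sum_stabilizer: "sum_complete (sum_stabilizer X)"
  unfolding sum_complete_def sum_stabilizer_def
  by (auto simp: fin_perm_perm_sum perm_sum_assoc[symmetric])

lemma closed_sum_stabilizer: assumes "closed_class X" shows "closed_class (sum_stabilizer X)"
  unfolding closed_class_def
proof (intro conjI ballI allI impI)
  fix \<alpha> \<delta> assume a: "\<alpha> \<in> sum_stabilizer X" and d: "fin_perm \<delta> \<and> \<delta> \<preceq> \<alpha>"
  show "\<delta> \<in> sum_stabilizer X" unfolding sum_stabilizer_def
  proof (intro CollectI conjI ballI)
    fix \<tau> assume t: "\<tau> \<in> X"
    then have "\<tau> \<oplus> \<alpha> \<in> X" "fin_perm \<alpha>" using a by (simp_all add: sum_stabilizer_def)
    moreover have "fin_perm \<tau>" using t assms unfolding closed_class_def by blast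
    moreover have "\<tau> \<oplus> \<delta> \<preceq> \<tau> \<oplus> \<alpha>" "fin_perm (\<tau> \<oplus> \<delta>)"
      using d calculation involved_perm_sum_mono fin_perm_perm_sum by simp_all
    ultimately show "\<tau> \<oplus> \<delta> \<in> X" using assms unfolding closed_class_def by blast
  qed (use d in simp)
qed (simp add: sum_stabilizer_def)

text \<open>One inclusion is associativity with sum-completeness. For the other,
  \<open>\<tau>\<close> is taken at least as long as \<open>\<gamma>\<close>: in a decomposition of
  \<open>\<tau> \<oplus> \<sigma>\<close> the part from \<open>Sub_fin \<gamma>\<close> ends within
  \<open>\<tau>\<close>, so \<open>\<sigma>\<close> lies inside the part from
  \<open>S\<close>.\<close>

lemma sum_stabilizer_unique:
  assumes long: "\<And>K. \<exists>\<tau>\<in>X. K \<le> length \<tau>"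
    and S: "closed_class S" "sum_complete S" "X = Sub_fin \<gamma> \<oplus>\<^sub>C S"
  shows "S = sum_stabilizer X"
proof
  show "S \<subseteq> sum_stabilizer X"
  proof
    fix \<sigma> assume s: "\<sigma> \<in> S"
    have "\<tau> \<oplus> \<sigma> \<in> X" if t: "\<tau> \<in> X" for \<tau>
    proof -
      obtain \<alpha> \<beta> where "\<tau> = \<alpha> \<oplus> \<beta>" "\<alpha> \<in> Sub_fin \<gamma>" "\<beta> \<in> S" using t S(3) by (auto simp: class_sum_def)
      moreover have "\<beta> \<oplus> \<sigma> \<in> S" using S(2) s calculation(3) by (auto simp: sum_complete_def)
      ultimately show ?thesis using S(3) by (auto simp: class_sum_def perm_sum_assoc)
    qed
    moreover have "fin_perm \<sigma>" using S(1) s by (simp add: closed_class_def)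
    ultimately show "\<sigma> \<in> sum_stabilizer X" by (simp add: sum_stabilizer_def)
  qed
  show "sum_stabilizer X \<subseteq> S"
  proof
    fix \<sigma> assume s: "\<sigma> \<in> sum_stabilizer X"
    obtain \<tau> where t: "\<tau> \<in> X" "length \<gamma> \<le> length \<tau>" using long by blast
    then have "\<tau> \<oplus> \<sigma> \<in> X" using s by (simp add: sum_stabilizer_def)
    then obtain \<alpha> \<beta> where ab: "\<tau> \<oplus> \<sigma> = \<alpha> \<oplus> \<beta>" "\<alpha> \<in> Sub_fin \<gamma>" "\<beta> \<in> S"
      using S(3) by (auto simp: class_sum_def)
    have len: "length \<alpha> \<le> length \<tau>" using ab(2) t(2) involved_length by (force simp: Sub_fin_def)
    define d where "d = length \<tau> - length \<alpha>"
    have lens: "length \<tau> + length \<sigma> = length \<alpha> + length \<beta>" using arg_cong[OF ab(1), of length] by simp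
    have nth: "\<beta> ! (i + d) = \<sigma> ! i + d" if i: "i < length \<sigma>" for i
    proof -
      have "(\<tau> \<oplus> \<sigma>) ! (i + length \<tau>) = (\<alpha> \<oplus> \<beta>) ! (i + length \<tau>)" using ab(1) by simp
      then have "\<sigma> ! i + length \<tau> = \<beta> ! (i + length \<tau> - length \<alpha>) + length \<alpha>"
        using i len lens by (simp add: nth_perm_sum)
      moreover have "i + length \<tau> - length \<alpha> = i + d" using len by (simp add: d_def)
      ultimately have "\<sigma> ! i + length \<tau> = \<beta> ! (i + d) + length \<alpha>" by metis
      moreover have "length \<tau> = d + length \<alpha>" using len by (simp add: d_def)
      ultimately show ?thesis by linarith
    qed
    have "emb ((!) \<sigma>) {..<length \<sigma>} ((!) \<beta>) (\<lambda>i. i + d)" by (rule embI) (simp_all add: nth)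
    moreover have "(\<lambda>i. i + d) ` {..<length \<sigma>} \<subseteq> {..<length \<beta>}" using lens len by (auto simp: d_def)
    ultimately have "\<sigma> \<preceq> \<beta>" unfolding involved_iff by blast
    moreover have "fin_perm \<sigma>" using s by (simp add: sum_stabilizer_def)
    ultimately show "\<sigma> \<in> S" using S(1) ab(3) unfolding closed_class_def by blast
  qed
qed

text \<open>A sum decomposition just before position \<open>c\<close>; 0 is always a cut, with empty
  first summand.\<close>

definition cut :: "(nat \<Rightarrow> nat) \<Rightarrow> nat \<Rightarrow> bool" where
  "cut q c \<longleftrightarrow> (\<forall>i j. i < c \<and> c \<le> j \<longrightarrow> q i < q j)"

context
  fixes \<pi> :: "nat \<Rightarrow> nat" and q
  assumes pos: "pos_bij \<pi>"
  defines "q \<equiv> \<lambda>n. \<pi> (Suc n) - 1"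
begin

lemma mem_Sub_inf: "\<sigma> \<in> Sub_inf \<pi> \<longleftrightarrow> fin_perm \<sigma> \<and> occurs q ((!) \<sigma>) {..<length \<sigma>}"
  unfolding q_def by (rule Sub_inf_iff[OF pos])

interpretation nat_perm q
  unfolding q_def by unfold_locales (rule bij_shift[OF pos])

lemma Sub_inf_long: "\<exists>\<tau>\<in>Sub_inf \<pi>. K \<le> length \<tau>"
proof -
  obtain \<sigma> s where s: "fin_perm \<sigma>" "length \<sigma> = card {..<K}" "emb ((!) \<sigma>) {..<card {..<K}} q s"
    using pattern_exists[OF finite_lessThan inj_on] by blast
  then have "\<sigma> \<in> Sub_inf \<pi>" unfolding mem_Sub_inf occurs_def by auto
  then show ?thesis using s(2) by (intro bexI[of _ \<sigma>]) auto
qed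

text \<open>A recurring \<open>\<sigma>\<close> has copies above and to the right of any copy of
  \<open>\<tau>\<close>, so every \<open>\<tau> \<oplus> \<sigma>\<close> occurs.\<close>

lemma recurs_sum_stabilizer:
  assumes "fin_perm \<sigma>" "recurs q ((!) \<sigma>) {..<length \<sigma>}"
  shows "\<sigma> \<in> sum_stabilizer (Sub_inf \<pi>)"
  unfolding sum_stabilizer_def
proof (intro CollectI conjI ballI)
  fix \<tau> assume "\<tau> \<in> Sub_inf \<pi>"
  then have t: "fin_perm \<tau>" "occurs q ((!) \<tau>) {..<length \<tau>}" by (simp_all add: mem_Sub_inf)
  let ?A = "{..<length \<tau>}" and ?B = "(\<lambda>i. i + length \<tau>) ` {..<length \<sigma>}"
  have "occurs q ((!) (\<tau> \<oplus> \<sigma>)) (?A \<union> ?B)"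
  proof (rule occurs_join)
    have "emb ((!) (\<tau> \<oplus> \<sigma>)) ?A ((!) \<tau>) (\<lambda>i. i)" by (rule embI) (auto simp: nth_perm_sum)
    then show "occurs q ((!) (\<tau> \<oplus> \<sigma>)) ?A" by (rule occurs_image) (use t in simp)
    have "emb ((!) (\<tau> \<oplus> \<sigma>)) ?B ((!) \<sigma>) (\<lambda>i. i - length \<tau>)" by (rule embI) (auto simp: nth_perm_sum)
    then show "recurs q ((!) (\<tau> \<oplus> \<sigma>)) ?B" by (rule recurs_image) (use assms in \<open>simp add: image_image\<close>)
    fix i j assume ij: "i \<in> ?A" "j \<in> ?B"
    then obtain k where k: "j = k + length \<tau>" "k < length \<sigma>" by auto
    then show "i < j \<and> (\<tau> \<oplus> \<sigma>) ! i < (\<tau> \<oplus> \<sigma>) ! j"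
      using ij fin_perm_nth[OF t(1), of i] fin_perm_nth[OF assms(1) k(2)] by (auto simp: nth_perm_sum)
  qed simp
  moreover have "{..<length (\<tau> \<oplus> \<sigma>)} = ?A \<union> ?B"
  proof (intro equalityI subsetI)
    fix i assume "i \<in> {..<length (\<tau> \<oplus> \<sigma>)}"
    then have "i < length \<tau> \<or> i = (i - length \<tau>) + length \<tau> \<and> i - length \<tau> < length \<sigma>" by auto
    then show "i \<in> ?A \<union> ?B" by blast
  qed auto
  ultimately show "\<tau> \<oplus> \<sigma> \<in> Sub_inf \<pi>"
    using fin_perm_perm_sum[OF t(1) assms(1)] by (simp only: mem_Sub_inf)
qed (rule assms(1))

text \<open>\<open>\<gamma>\<close> is the pattern of the first \<open>c\<close> entries. An
  occurrence of a member splits at \<open>c\<close>: the part before is involved in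
  \<open>\<gamma>\<close>, the part after recurs and so lies in the stabilizer.\<close>

lemma Sub_inf_cut:
  assumes "cut q c" and rec: "\<And>A. finite A \<Longrightarrow> A \<subseteq> {c..} \<Longrightarrow> recurs q q A"
  shows "\<exists>\<gamma> S. fin_perm \<gamma> \<and> closed_class S \<and> sum_complete S \<and> Sub_inf \<pi> = Sub_fin \<gamma> \<oplus>\<^sub>C S"
proof -
  let ?S = "sum_stabilizer (Sub_inf \<pi>)"
  obtain \<gamma> s where \<gamma>: "fin_perm \<gamma>" "length \<gamma> = c" "emb ((!) \<gamma>) {..<c} q s" "s ` {..<c} = {..<c}"
    using pattern_exists[OF finite_lessThan[of c] inj_on] by (metis card_lessThan)
  note inv = emb_inv[OF \<gamma>(3), unfolded \<gamma>(4)]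
  have inv_im: "the_inv_into {..<c} s ` {..<c} = {..<c}"
    using the_inv_into_onto[OF emb_inj_on[OF \<gamma>(3)]] \<gamma>(4) by simp
  have "\<gamma> \<in> Sub_inf \<pi>" unfolding mem_Sub_inf occurs_def using \<gamma> by auto
  then have sub: "\<alpha> \<in> Sub_inf \<pi>" if "\<alpha> \<in> Sub_fin \<gamma>" for \<alpha>
    using that closed_Sub_inf[OF pos] unfolding closed_class_def Sub_fin_def by blast
  have "Sub_inf \<pi> = Sub_fin \<gamma> \<oplus>\<^sub>C ?S"
  proof
    show "Sub_fin \<gamma> \<oplus>\<^sub>C ?S \<subseteq> Sub_inf \<pi>"
      using sub by (auto simp: class_sum_def sum_stabilizer_def)
    show "Sub_inf \<pi> \<subseteq> Sub_fin \<gamma> \<oplus>\<^sub>C ?S"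
    proof
      fix \<sigma> assume "\<sigma> \<in> Sub_inf \<pi>"
      then obtain e where e: "fin_perm \<sigma>" "emb ((!) \<sigma>) {..<length \<sigma>} q e"
        by (auto simp: mem_Sub_inf occurs_def)
      \<comment> \<open>The number of entries placed before \<open>c\<close>. The alternative
        \<open>i = length \<sigma>\<close> keeps \<open>m\<close> within the list, as
        \<open>e\<close> is arbitrary beyond it.\<close>
      define m where "m = (LEAST i. i = length \<sigma> \<or> c \<le> e i)"
      have m: "m = length \<sigma> \<or> c \<le> e m" unfolding m_def by (rule LeastI[of _ "length \<sigma>"]) simp
      have mn: "m \<le> length \<sigma>" unfolding m_def by (rule Least_le) simp
      have below: "e i < c" if "i < m" for i using not_less_Least[OF that[unfolded m_def]] by simp
      have above: "c \<le> e i" if "m \<le> i" "i < length \<sigma>" for i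
        using m that mn emb_le[OF e(2), of m i] by auto
      have "\<sigma> ! i < \<sigma> ! j" if "i < m" "m \<le> j" "j < length \<sigma>" for i j
        using assms(1) below[of i] above[of j] that mn emb_val_less[OF e(2), of i j]
        unfolding cut_def by auto
      then obtain \<alpha> \<beta> where ab: "fin_perm \<alpha>" "fin_perm \<beta>" "\<sigma> = \<alpha> \<oplus> \<beta>" "length \<alpha> = m"
        using fin_perm_split[OF e(1) mn] by blast
      have ea: "emb ((!) \<alpha>) {..<m} q e"
        using emb_comp[OF emb_perm_sum_left[of \<alpha> \<beta>] emb_subset[OF e(2)[unfolded ab(3)]]] ab by simp
      have eb: "emb ((!) \<beta>) {..<length \<beta>} q (\<lambda>i. e (i + m))"
        using emb_comp[OF emb_perm_sum_right[of \<beta> \<alpha>] emb_subset[OF e(2)[unfolded ab(3)]]] ab by (simp add: image_subset_iff)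
      have "(\<lambda>i. e (i + m)) ` {..<length \<beta>} \<subseteq> {c..}" using above ab by auto
      then have "recurs q ((!) \<beta>) {..<length \<beta>}" using recurs_image[OF eb] rec by simp
      then have "\<beta> \<in> ?S" using ab(2) recurs_sum_stabilizer by blast
      moreover have "\<alpha> \<preceq> \<gamma>"
      proof -
        have im: "e ` {..<m} \<subseteq> {..<c}" using below by auto
        have "emb ((!) \<alpha>) {..<m} ((!) \<gamma>) (\<lambda>i. the_inv_into {..<c} s (e i))"
          by (rule emb_comp[OF ea emb_subset[OF inv im]])
        moreover have "(\<lambda>i. the_inv_into {..<c} s (e i)) ` {..<m} \<subseteq> {..<c}"
          using im inv_im by (metis image_image image_mono)
        ultimately show ?thesis unfolding involved_iff using ab(4) \<gamma>(2) by blast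
      qed
      ultimately show "\<sigma> \<in> Sub_fin \<gamma> \<oplus>\<^sub>C ?S"
        using ab by (auto simp: class_sum_def Sub_fin_def)
    qed
  qed
  then show ?thesis
    using \<gamma>(1) closed_sum_stabilizer[OF closed_Sub_inf[OF pos]] sum_complete_sum_stabilizer by blast
qed

end

section \<open>Levels and rigidity\<close>

text \<open>Diagonal argument: infinitely many \<open>k\<close> agree on an initial segment, and
  pigeonhole fixes one further value at a time.\<close>

lemma bounded_sequence_limit:
  fixes f :: "nat \<Rightarrow> nat \<Rightarrow> nat"
  assumes bound: "\<And>k i. i \<le> k \<Longrightarrow> f k i \<le> K i"
  shows "\<exists>g. \<forall>n. \<exists>k\<ge>n. \<forall>i\<le>n. f k i = g i"
proof -
  have "\<exists>H. \<forall>n. infinite {k. \<forall>i<n. f k i = H n i} \<and> (\<forall>i<n. H (Suc n) i = H n i)"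
  proof (rule dependent_nat_choice)
    show "\<exists>h. infinite {k. \<forall>i<0. f k i = h i}" by simp
    fix h n assume inf: "infinite {k. \<forall>i<n. f k i = h i}" (is "infinite ?S")
    \<comment> \<open>The bound on \<open>f k n\<close> is available only for
      \<open>n \<le> k\<close>, so smaller \<open>k\<close> are dropped first.\<close>
    have "infinite (?S - {..<n})" using inf by (rule Diff_infinite_finite[rotated]) simp
    moreover have "finite ((\<lambda>k. f k n) ` (?S - {..<n}))"
      by (rule finite_subset[of _ "{..K n}"]) (auto intro!: bound)
    ultimately obtain k0 where "infinite {k \<in> ?S - {..<n}. f k n = f k0 n}"
      using pigeonhole_infinite by blast
    then have "infinite {k. \<forall>i<Suc n. f k i = (h(n := f k0 n)) i}"
      by (rule infinite_super[rotated]) (auto simp: less_Suc_eq)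
    then show "\<exists>h'. infinite {k. \<forall>i<Suc n. f k i = h' i} \<and> (\<forall>i<n. h' i = h i)"
      by (intro exI[of _ "h(n := f k0 n)"]) simp
  qed
  then obtain H where H: "\<And>n. infinite {k. \<forall>i<n. f k i = H n i}" "\<And>n i. i < n \<Longrightarrow> H (Suc n) i = H n i"
    by blast
  have stable: "H (Suc i + d) i = H (Suc i) i" for i d
    by (induction d) (simp_all add: H(2))
  have "\<exists>k\<ge>n. \<forall>i\<le>n. f k i = H (Suc i) i" for n
  proof -
    obtain k where k: "k \<ge> n" "\<forall>i<Suc n. f k i = H (Suc n) i"
      using H(1)[of "Suc n"] unfolding finite_nat_set_iff_bounded by (auto simp: linorder_not_less)
    have "f k i = H (Suc i) i" if "i \<le> n" for i
      using k(2) that stable[of i "n - i"] by simp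
    then show ?thesis using k(1) by blast
  qed
  then show ?thesis by (intro exI[of _ "\<lambda>i. H (Suc i) i"]) simp
qed

section \<open>Greedy growth and its transport along embeddings\<close>

definition peak :: "(nat \<Rightarrow> nat) \<Rightarrow> nat \<Rightarrow> nat" where
  "peak q n = Max (q ` {..n})"

text \<open>For a bijection the set is finite, and \<open>reach q n = n\<close> holds precisely when
  \<open>q\<close> has a cut at \<open>Suc n\<close>.\<close>

definition reach :: "(nat \<Rightarrow> nat) \<Rightarrow> nat \<Rightarrow> nat" where
  "reach q n = Max {i. q i \<le> peak q n}"

lemma peak_ge: "i \<le> n \<Longrightarrow> q i \<le> peak q n"
  by (simp add: peak_def)

lemma peak_attained: "\<exists>i\<le>n. q i = peak q n"
proof -
  have "Max (q ` {..n}) \<in> q ` {..n}" by (rule Max_in) auto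
  then show ?thesis unfolding peak_def by (metis atMost_iff imageE)
qed

lemma peak_mono: "m \<le> n \<Longrightarrow> peak q m \<le> peak q n"
  unfolding peak_def by (intro Max_mono image_mono) auto

context nat_perm
begin

lemma le_peak: "n \<le> peak \<pi> n"
proof -
  have "\<pi> ` {..n} \<subseteq> {..peak \<pi> n}" using peak_ge by auto
  then have "card (\<pi> ` {..n}) \<le> card {..peak \<pi> n}" by (intro card_mono) auto
  then show ?thesis by (simp add: card_image[OF inj_on])
qed

lemma le_reachI: "\<pi> i \<le> peak \<pi> n \<Longrightarrow> i \<le> reach \<pi> n"
  unfolding reach_def using finite_le by simp

lemma peak_less: "reach \<pi> n < i \<Longrightarrow> peak \<pi> n < \<pi> i"
  using le_reachI[of i n] by (meson linorder_not_le)

lemma reach_val: "\<pi> (reach \<pi> n) \<le> peak \<pi> n"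
proof -
  have "n \<in> {i. \<pi> i \<le> peak \<pi> n}" by (simp add: peak_ge)
  then have "reach \<pi> n \<in> {i. \<pi> i \<le> peak \<pi> n}"
    unfolding reach_def using finite_le[of "peak \<pi> n"] by (intro Max_in) blast+
  then show ?thesis by simp
qed

lemma le_reach: "n \<le> reach \<pi> n"
  by (rule le_reachI) (simp add: peak_ge)

lemma reach_mono: "m \<le> n \<Longrightarrow> reach \<pi> m \<le> reach \<pi> n"
  using reach_val[of m] peak_mono[of m n \<pi>] by (intro le_reachI) simp

text \<open>The value at \<open>f y\<close> is at most that at \<open>f a\<close>, a position no
  later than \<open>f x\<close>; thus inversions keep an embedding from pulling positions far
  apart.\<close>

lemma emb_reach:
  assumes "emb p A \<pi> f" "a \<in> A" "x \<in> A" "y \<in> A" "a \<le> x" "p y \<le> p a"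
  shows "f y \<le> reach \<pi> (f x)"
proof (rule le_reachI)
  have "\<pi> (f y) \<le> \<pi> (f a)" using emb_val_le[OF assms(1,4,2)] assms(6) by simp
  also have "\<dots> \<le> peak \<pi> (f x)" using emb_le[OF assms(1,2,3)] assms(5) by (simp add: peak_ge)
  finally show "\<pi> (f y) \<le> peak \<pi> (f x)" .
qed

end

text \<open>The value at \<open>i\<close> is the number of positions with smaller value.\<close>

lemma bij_order_determined:
  fixes \<pi> \<pi>' :: "nat \<Rightarrow> nat"
  assumes "bij \<pi>" "bij \<pi>'" "\<And>i j. \<pi> i < \<pi> j \<longleftrightarrow> \<pi>' i < \<pi>' j"
  shows "\<pi> = \<pi>'"
proof
  fix i
  have *: "card {j. q j < q i} = q i" if "bij q" for q :: "nat \<Rightarrow> nat"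
  proof -
    have "card (q -` {..<q i}) = card {..<q i}"
      by (rule card_vimage_inj) (use that in \<open>auto simp: bij_def\<close>)
    moreover have "q -` {..<q i} = {j. q j < q i}" by auto
    ultimately show ?thesis by simp
  qed
  show "\<pi> i = \<pi>' i" using *[OF assms(1)] *[OF assms(2)] assms(3) by simp
qed

text \<open>The situation opposite to a cut with recurring tail. The non-recurring pattern
  \<open>C\<close>, starting no earlier than the root \<open>c\<close>, anchors embeddings near the
  root.\<close>

locale rooted_perm = based_perm +
  fixes c n0 :: nat and C :: "nat set"
  assumes no_cut: "\<And>d. c < d \<Longrightarrow> \<not> cut \<pi> d"
    and recurs_tail: "\<And>A. finite A \<Longrightarrow> A \<subseteq> {n0..} \<Longrightarrow> recurs \<pi> \<pi> A"
    and C: "finite C" "C \<subseteq> {c..}" "\<not> recurs \<pi> \<pi> C"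

text \<open>A cut beyond \<open>n0\<close> would have a recurring tail, so cuts are bounded; 0 is
  one, and the root is the greatest.\<close>

lemma (in based_perm) rooted_exists:
  assumes "\<not> (\<exists>c. cut \<pi> c \<and> (\<forall>A. finite A \<and> A \<subseteq> {c..} \<longrightarrow> recurs \<pi> \<pi> A))"
  shows "\<exists>c n0 C. rooted_perm \<pi> b c n0 C"
proof -
  obtain n0 where n0: "\<forall>A. finite A \<and> A \<subseteq> {n0..} \<longrightarrow> recurs \<pi> \<pi> A" using eventually_recurs by blast
  have bound: "d \<le> n0" if "cut \<pi> d" for d
  proof (rule ccontr)
    assume "\<not> d \<le> n0"
    then have "{d..} \<subseteq> {n0..}" by simp
    then have "\<forall>A. finite A \<and> A \<subseteq> {d..} \<longrightarrow> recurs \<pi> \<pi> A" using n0 subset_trans by metis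
    then show False using assms that by metis
  qed
  have "cut \<pi> 0" by (simp add: cut_def)
  then obtain c where c: "cut \<pi> c" "\<And>d. cut \<pi> d \<Longrightarrow> d \<le> c"
    using GreatestI_nat[of "cut \<pi>" 0 n0] Greatest_le_nat[of "cut \<pi>" _ n0] bound by metis
  then obtain C where C: "finite C" "C \<subseteq> {c..}" "\<not> recurs \<pi> \<pi> C" using assms by metis
  have "rooted_perm \<pi> b c n0 C"
  proof
    show "\<not> cut \<pi> d" if "c < d" for d using c(2) that linorder_not_le by metis
    show "recurs \<pi> \<pi> A" if "finite A" "A \<subseteq> {n0..}" for A using n0 that by simp
  qed (rule C)+
  then show ?thesis by blast
qed

section \<open>Levels, bounded embeddings and self-embeddings\<close>

context rooted_perm
begin

definition w :: "nat \<Rightarrow> nat" where "w k = (reach \<pi> ^^ k) c"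

text \<open>The position of the maximum up to \<open>w k\<close>. It forms an inversion with
  \<open>w (Suc k)\<close>, and these inversions chain consecutive levels together.\<close>

definition u :: "nat \<Rightarrow> nat" where "u k = (SOME i. i \<le> w k \<and> \<pi> i = peak \<pi> (w k))"

lemma w_0 [simp]: "w 0 = c" by (simp add: w_def)

lemma w_Suc: "w (Suc k) = reach \<pi> (w k)" by (simp add: w_def)

lemma u_le: "u k \<le> w k" and u_val: "\<pi> (u k) = peak \<pi> (w k)"
  using someI_ex[OF peak_attained[where q = \<pi> and n = "w k"]] by (auto simp: u_def)

text \<open>Here the absence of cuts enters: some value after \<open>n\<close> lies below the peak,
  so the levels keep growing.\<close>

lemma reach_gt: assumes "c \<le> n" shows "n < reach \<pi> n"
proof -
  obtain i j where ij: "i < Suc n" "Suc n \<le> j" "\<not> \<pi> i < \<pi> j"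
    using no_cut[of "Suc n"] assms unfolding cut_def by auto
  then have "\<pi> j \<le> peak \<pi> n" using peak_ge[of i n \<pi>] by simp
  then show ?thesis using le_reachI ij(2) by fastforce
qed

lemma c_le_w: "c \<le> w k"
proof (induction k)
  case (Suc k) then show ?case using le_reach[of "w k"] by (simp add: w_Suc)
qed simp

lemma w_less_Suc: "w k < w (Suc k)"
  by (simp add: w_Suc reach_gt c_le_w)

lemma w_strict_mono: "strict_mono w"
  by (simp add: strict_mono_Suc_iff w_less_Suc)

lemma w_less_iff [simp]: "w i < w j \<longleftrightarrow> i < j"
  using w_strict_mono by (rule strict_mono_less)

lemma w_le_iff [simp]: "w i \<le> w j \<longleftrightarrow> i \<le> j"
  using w_strict_mono by (rule strict_mono_less_eq)

lemma le_w: "k \<le> w k"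
  using w_strict_mono by (rule strict_mono_imp_increasing)

lemma pi_w_Suc_le: "\<pi> (w (Suc k)) \<le> \<pi> (u k)"
  by (simp add: w_Suc u_val reach_val)

text \<open>Points separated by a full level are in sum position. A set that misses a level
  therefore splits there, which is how the bounded basis is exploited below.\<close>

lemma level_less: assumes "i \<le> w k" "w (Suc k) < j" shows "\<pi> i < \<pi> j"
  using peak_ge[OF assms(1), of \<pi>] peak_less[of "w k" j] assms(2) by (simp add: w_Suc)

lemma C_subset: "\<exists>k. \<forall>j\<ge>k. C \<subseteq> {..w j}"
proof -
  obtain m where "C \<subseteq> {..m}" using C(1) finite_nat_set_iff_bounded_le by auto
  moreover have "{..m} \<subseteq> {..w j}" if "m \<le> j" for j using le_w[of j] that by auto
  ultimately show ?thesis by (meson subset_trans)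
qed

text \<open>Iterates \<open>emb_reach\<close> along the inversions between \<open>u\<close> and
  \<open>w\<close>. Only these points need to lie in \<open>A\<close>, so the bound also serves
  patterns that keep just a path through some levels.\<close>

lemma emb_w_bound:
  assumes "nat_perm \<pi>'" "emb p A \<pi>' f" "f (w i) \<le> B"
    and "\<And>j. j < m \<Longrightarrow> u (i + j) \<in> A \<and> w (i + j) \<in> A \<and> w (Suc (i + j)) \<in> A \<and> p (w (Suc (i + j))) \<le> p (u (i + j))"
  shows "f (w (i + m)) \<le> (reach \<pi>' ^^ m) B"
  using assms(4)
proof (induction m)
  case 0 then show ?case using assms(3) by simp
next
  case (Suc m)
  have "f (w (Suc (i + m))) \<le> reach \<pi>' (f (w (i + m)))"
    by (rule nat_perm.emb_reach[OF assms(1,2), of "u (i + m)"]) (use Suc.prems[of m] u_le in auto)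
  also have "\<dots> \<le> reach \<pi>' ((reach \<pi>' ^^ m) B)"
    by (rule nat_perm.reach_mono[OF assms(1)]) (use Suc in simp)
  finally show ?case by simp
qed

text \<open>Once the images of \<open>c\<close> are bounded, the image of \<open>i \<le> w i\<close>
  is bounded by an iterate of \<open>reach \<pi>'\<close> independent of \<open>k\<close>, and
  compactness yields a limit agreeing with some \<open>F k\<close> on each finite segment.\<close>

lemma limit_emb:
  assumes "nat_perm \<pi>'" "\<And>k. emb \<pi> {..w k} \<pi>' (F k)" "\<And>k. F k c \<le> B"
  shows "\<exists>g. emb \<pi> UNIV \<pi>' g \<and> (\<forall>n. \<exists>k\<ge>n. \<forall>i\<le>n. F k i = g i)"
proof -
  have "F k i \<le> (reach \<pi>' ^^ i) B" if "i \<le> k" for k i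
  proof -
    have 1: "F k i \<le> F k (w i)"
      using emb_le[OF assms(2)[of k], of i "w i"] le_w[of i] le_w[of k] that by auto
    have "F k (w (0 + i)) \<le> (reach \<pi>' ^^ i) B"
    proof (rule emb_w_bound[OF assms(1) assms(2)[of k]])
      show "F k (w 0) \<le> B" using assms(3) by simp
      show "u (0 + j) \<in> {..w k} \<and> w (0 + j) \<in> {..w k} \<and> w (Suc (0 + j)) \<in> {..w k} \<and> \<pi> (w (Suc (0 + j))) \<le> \<pi> (u (0 + j))"
        if "j < i" for j
      proof -
        have "w j \<le> w k" using that \<open>i \<le> k\<close> by simp
        then have "u j \<le> w k" using u_le[of j] le_trans by blast
        then show ?thesis using that \<open>i \<le> k\<close> pi_w_Suc_le[of j] by simp
      qed
    qed
    then show ?thesis using 1 by simp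
  qed
  then have "\<exists>g. \<forall>n. \<exists>k\<ge>n. \<forall>i\<le>n. F k i = g i" by (rule bounded_sequence_limit)
  then obtain g where g: "\<forall>n. \<exists>k\<ge>n. \<forall>i\<le>n. F k i = g i" ..
  have "(i < j \<longleftrightarrow> g i < g j) \<and> (\<pi> i < \<pi> j \<longleftrightarrow> \<pi>' (g i) < \<pi>' (g j))" for i j
  proof -
    obtain k where k: "k \<ge> max i j" "\<forall>l\<le>max i j. F k l = g l" using g by blast
    then have "i \<le> w k" "j \<le> w k" using le_w[of k] by auto
    with assms(2)[of k] have "(i < j \<longleftrightarrow> F k i < F k j) \<and> (\<pi> i < \<pi> j \<longleftrightarrow> \<pi>' (F k i) < \<pi>' (F k j))"
      by (simp add: emb_def)
    then show ?thesis using k(2) by simp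
  qed
  then have "emb \<pi> UNIV \<pi>' g" by (simp add: emb_def)
  then show ?thesis using g by blast
qed

text \<open>If \<open>f c\<close> were at least \<open>n1\<close>, all of \<open>C\<close> would
  land in the recurring tail of \<open>\<pi>'\<close> and so would recur itself.\<close>

lemma emb_root_bounded:
  assumes "emb p A \<pi>' f" "C \<subseteq> A" "c \<in> A" "\<not> recurs \<pi>' p C"
    and rec: "\<And>A. finite A \<Longrightarrow> A \<subseteq> {n1..} \<Longrightarrow> recurs \<pi>' \<pi>' A"
  shows "f c < n1"
proof (rule ccontr)
  assume ge: "\<not> f c < n1"
  have "f ` C \<subseteq> {n1..}"
  proof (rule image_subsetI)
    fix i assume i: "i \<in> C"
    then have "f c \<le> f i" using emb_le[OF assms(1,3), of i] assms(2) C(2) by auto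
    then show "f i \<in> {n1..}" using ge by simp
  qed
  then have "recurs \<pi>' \<pi>' (f ` C)" using rec C(1) by simp
  then have "recurs \<pi>' p C" using recurs_image[OF emb_subset[OF assms(1,2)]] by blast
  with assms(4) show False ..
qed

text \<open>Every initial segment of \<open>\<pi>\<close> occurs in \<open>\<pi>'\<close>, and the
  non-recurring \<open>C\<close> keeps the images of \<open>c\<close> below \<open>n1\<close>; the
  limit is a total embedding.\<close>

lemma total_emb_exists:
  assumes "nat_perm \<pi>'"
    and same: "\<And>p A. finite A \<Longrightarrow> inj_on p A \<Longrightarrow> occurs \<pi> p A = occurs \<pi>' p A"
    and rec: "\<And>A. finite A \<Longrightarrow> A \<subseteq> {n1..} \<Longrightarrow> recurs \<pi>' \<pi>' A"
  shows "\<exists>g. emb \<pi> UNIV \<pi>' g"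
proof -
  obtain k0 where k0: "\<And>j. k0 \<le> j \<Longrightarrow> C \<subseteq> {..w j}" using C_subset by blast
  \<comment> \<open>The shift by \<open>k0\<close> puts \<open>C\<close> into every domain.\<close>
  have "occurs \<pi>' \<pi> {..w (k + k0)}" for k using same[of "{..w (k + k0)}" \<pi>] occurs_self inj_on by auto
  then obtain F where F: "\<And>k. emb \<pi> {..w (k + k0)} \<pi>' (F k)" unfolding occurs_def by metis
  have nr: "\<not> recurs \<pi>' \<pi> C"
    using recurs_transfer[OF nat_perm_axioms assms(1) same _ C(1) inj_on] C(3) by blast
  have "F k c < n1" for k
    by (rule emb_root_bounded[OF F[of k] k0 _ nr rec]) (use c_le_w in auto)
  moreover have "emb \<pi> {..w k} \<pi>' (F k)" for k
    by (rule emb_subset[OF F]) auto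
  ultimately show ?thesis using limit_emb[OF assms(1), of F n1] by (meson less_imp_le)
qed

lemma emb_funpow:
  assumes "emb \<pi> UNIV \<pi> g" shows "emb \<pi> UNIV \<pi> (g ^^ m)"
proof (induction m)
  case 0 show ?case using emb_id by (simp add: id_def)
next
  case (Suc m)
  then show ?case using emb_comp_UNIV[OF Suc.IH assms] by (simp add: comp_def)
qed

text \<open>If \<open>g\<close> moves \<open>i\<close>, it moves everything after \<open>i\<close>
  strictly to the right, so its iterates carry \<open>w i\<close> arbitrarily far. Levels cannot be
  stretched, so \<open>c\<close> and with it \<open>C\<close> are carried arbitrarily far too,
  making \<open>C\<close> recur.\<close>

lemma total_emb_id:
  assumes g: "emb \<pi> UNIV \<pi> g" shows "g i = i"
proof (rule ccontr)
  assume "g i \<noteq> i"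
  then have gi: "i < g i" using emb_increasing[OF g, of i] by simp
  have up: "j < g j" if "i \<le> j" for j
    using that
  proof (induction j rule: dec_induct)
    case (step j)
    then show ?case using emb_less[OF g, of j "Suc j"] by simp
  qed (rule gi)
  have far: "w i + m \<le> (g ^^ m) (w i)" for m
  proof (induction m)
    case (Suc m)
    then show ?case using up[of "(g ^^ m) (w i)"] le_w[of i] by simp
  qed simp
  have "recurs \<pi> \<pi> C"
    unfolding recurs_def
  proof
    fix n
    have "\<exists>m. n \<le> (g ^^ m) c"
    proof (rule ccontr)
      assume "\<not> ?thesis"
      then have less: "(g ^^ m) c \<le> n" for m by (meson linorder_le_cases)
      have "(g ^^ m) (w (0 + i)) \<le> (reach \<pi> ^^ i) n" for m
        by (rule emb_w_bound[OF nat_perm_axioms emb_funpow[OF g]]) (use less pi_w_Suc_le in auto)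
      then have "w i + m \<le> (reach \<pi> ^^ i) n" for m using far[of m] le_trans by fastforce
      from this[of "Suc ((reach \<pi> ^^ i) n)"] show False by simp
    qed
    then obtain m where m: "n \<le> (g ^^ m) c" by blast
    have "n \<le> (g ^^ m) j" if "j \<in> C" for j
      using m emb_le[OF emb_funpow[OF g, of m], of c j] that C(2) by auto
    then show "\<exists>e. emb \<pi> C \<pi> e \<and> (\<forall>i\<in>C. n \<le> e i)"
      using emb_subset[OF emb_funpow[OF g, of m]] by blast
  qed
  with C(3) show False ..
qed

text \<open>Otherwise embeddings of ever longer initial segments that move \<open>c\<close> would
  have as a limit a total self-embedding moving \<open>c\<close>.\<close>

lemma root_fixed: "\<exists>k. \<forall>f. emb \<pi> {..w k} \<pi> f \<longrightarrow> f c = c"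
proof (rule ccontr)
  assume "\<not> ?thesis"
  then obtain F where F: "\<And>k. emb \<pi> {..w k} \<pi> (F k)" "\<And>k. F k c \<noteq> c" by metis
  obtain k0 where k0: "\<And>j. k0 \<le> j \<Longrightarrow> C \<subseteq> {..w j}" using C_subset by blast
  have "F (k + k0) c < n0" for k
    by (rule emb_root_bounded[OF F(1)[of "k + k0"] k0 _ C(3) recurs_tail]) (use c_le_w in auto)
  moreover have "emb \<pi> {..w k} \<pi> (F (k + k0))" for k
    by (rule emb_subset[OF F(1)]) auto
  ultimately obtain g where "emb \<pi> UNIV \<pi> g" "\<forall>n. \<exists>k\<ge>n. \<forall>i\<le>n. F (k + k0) i = g i"
    using limit_emb[OF nat_perm_axioms, of "\<lambda>k. F (k + k0)" n0] by (meson less_imp_le)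
  then show False using total_emb_id[of g] F(2) by (metis order_refl)
qed

end

text \<open>Total embeddings \<open>f\<close> and \<open>g\<close> exist in both directions and
  \<open>g\<close> after \<open>f\<close> is the identity; as neither decreases positions,
  \<open>f\<close> is the identity as well.\<close>

lemma rooted_perm_unique:
  assumes "rooted_perm \<pi> b c n0 C" "rooted_perm \<pi>' b' c' n0' C'"
    and same: "\<And>p A. finite A \<Longrightarrow> inj_on p A \<Longrightarrow> occurs \<pi> p A = occurs \<pi>' p A"
  shows "\<pi> = \<pi>'"
proof -
  interpret P: rooted_perm \<pi> b c n0 C by fact
  interpret P': rooted_perm \<pi>' b' c' n0' C' by fact
  obtain f where f: "emb \<pi> UNIV \<pi>' f"
    using P.total_emb_exists[OF P'.nat_perm_axioms same P'.recurs_tail] by blast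
  obtain g where g: "emb \<pi>' UNIV \<pi> g"
    using P'.total_emb_exists[OF P.nat_perm_axioms same[symmetric] P.recurs_tail] by blast
  have "g (f i) = i" for i using P.total_emb_id[OF emb_comp_UNIV[OF f g]] .
  then have "f i = i" for i
    using emb_increasing[OF f, of i] emb_increasing[OF g, of "f i"] by simp
  then have "\<pi> i < \<pi> j \<longleftrightarrow> \<pi>' i < \<pi>' j" for i j using f by (simp add: emb_def)
  then show ?thesis using bij_order_determined P.bij P'.bij by blast
qed

section \<open>Boundedness of the levels\<close>

text \<open>Images strictly increase along the interval, so its last point goes to at least its
  length minus one. This bounds the size of a level by the image of its end.\<close>

lemma emb_interval_length:
  assumes "emb p A q f" "{m<..n} \<subseteq> A" "m < n"
  shows "n \<le> Suc m + f n"
proof -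
  have "t \<le> f (Suc (m + t))" if "Suc (m + t) \<le> n" for t
    using that
  proof (induction t)
    case (Suc t)
    then have "Suc (m + t) \<in> {m<..n}" "Suc (m + Suc t) \<in> {m<..n}" by simp_all
    then have "f (Suc (m + t)) < f (Suc (m + Suc t))"
      using emb_less[OF assms(1), of "Suc (m + t)" "Suc (m + Suc t)"] assms(2) subsetD by fastforce
    then show ?case using Suc by simp
  qed simp
  from this[of "n - Suc m"] assms(3) show ?thesis by simp
qed

text \<open>The order pattern of a greedy path: its positions alternate \<open>u\<^sub>k, w\<^sub>k, u\<^sub>k\<^sub>+\<^sub>1, \<dots>\<close>
  and its values alternate \<open>w\<^sub>k\<^sub>+\<^sub>1, u\<^sub>k, w\<^sub>k\<^sub>+\<^sub>2, \<dots>\<close>.\<close>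

definition osc_rank :: "nat \<Rightarrow> nat" where
  "osc_rank a = (if even a then a + 1 else a - 3)"

section \<open>The greedy path and the splicing of a far level\<close>

context rooted_perm
begin

definition path :: "nat \<Rightarrow> nat" where
  "path a = (if even a then u (a div 2) else w (a div 2))"

text \<open>Values along the path in increasing order: for \<open>3 \<le> a\<close>,
  \<open>osc_rank a\<close> is the place in this list of the value at \<open>path a\<close>. The
  value at \<open>w 0\<close> is not listed.\<close>

definition path_val :: "nat \<Rightarrow> nat" where
  "path_val t = (if even t then \<pi> (w (Suc (t div 2))) else \<pi> (u (t div 2)))"

lemma path_even [simp]: "path (2 * k) = u k" and path_odd [simp]: "path (Suc (2 * k)) = w k"
  by (simp_all add: path_def)

text \<open>If the maximum did not grow, \<open>w (Suc (Suc k))\<close> would already have been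
  reached from \<open>w k\<close>.\<close>

lemma peak_w_less: "peak \<pi> (w k) < peak \<pi> (w (Suc k))"
proof (rule ccontr)
  assume "\<not> ?thesis"
  then have "\<pi> (w (Suc (Suc k))) \<le> peak \<pi> (w k)"
    using reach_val[of "w (Suc k)"] by (simp add: w_Suc)
  then have "w (Suc (Suc k)) \<le> w (Suc k)" using le_reachI by (simp only: w_Suc)
  then show False by simp
qed

lemma u_Suc_gt: "w k < u (Suc k)"
  using peak_w_less[of k] peak_ge[of "u (Suc k)" "w k" \<pi>] by (simp add: u_val) (meson linorder_not_le)

lemma u_Suc_less: "u (Suc k) < w (Suc k)"
proof -
  have "\<pi> (w (Suc k)) \<le> peak \<pi> (w k)" by (simp add: w_Suc reach_val)
  then have "\<pi> (w (Suc k)) \<noteq> \<pi> (u (Suc k))" using peak_w_less[of k] u_val[of "Suc k"] by linarith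
  then show ?thesis using u_le[of "Suc k"] by (simp add: le_less)
qed

text \<open>Index 0 is excluded because \<open>u 0\<close> may coincide with
  \<open>w 0\<close>.\<close>

lemma path_less_Suc: assumes "1 \<le> a" shows "path a < path (Suc a)"
proof (cases "even a")
  case True
  then obtain k where "a = 2 * Suc k" using assms by (metis evenE not_one_le_zero mult_0_right old.nat.exhaust)
  then show ?thesis using u_Suc_less[of k] path_even[of "Suc k"] path_odd[of "Suc k"] by simp
next
  case False
  then obtain k where k: "a = Suc (2 * k)" by (metis oddE Suc_eq_plus1)
  then have "Suc a = 2 * Suc k" by simp
  then show ?thesis using u_Suc_gt[of k] path_even[of "Suc k"] path_odd[of k] k by metis
qed

lemma path_less: assumes "1 \<le> a" "a < a'" shows "path a < path a'"
  using assms(2)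
proof (induction a')
  case (Suc a')
  then show ?case using path_less_Suc[of a'] assms(1) by (cases "a = a'") auto
qed simp

lemma path_eq_iff: "1 \<le> a \<Longrightarrow> 1 \<le> a' \<Longrightarrow> path a = path a' \<longleftrightarrow> a = a'"
  using path_less by (metis less_irrefl linorder_neqE_nat)

lemma path_val_strict_mono: "strict_mono path_val"
  unfolding strict_mono_Suc_iff
proof
  fix t
  show "path_val t < path_val (Suc t)"
  proof (cases "even t")
    case True
    then obtain k where k: "t = 2 * k" by blast
    have "\<pi> (w (Suc k)) \<noteq> \<pi> (u k)" using u_le[of k] w_less_Suc[of k] by (simp del: w_less_iff)
    then have "\<pi> (w (Suc k)) < \<pi> (u k)" using pi_w_Suc_le[of k] by (simp add: le_less del: eq_iff)
    then show ?thesis by (simp add: path_val_def k)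
  next
    case False
    then obtain k where k: "t = Suc (2 * k)" by (metis oddE Suc_eq_plus1)
    have "\<pi> (u k) < \<pi> (w (Suc (Suc k)))" by (rule level_less[OF u_le]) simp
    then show ?thesis by (simp add: path_val_def k)
  qed
qed

lemma pi_path: assumes "3 \<le> a" shows "\<pi> (path a) = path_val (osc_rank a)"
proof (cases "even a")
  case True
  then show ?thesis by (auto simp: path_val_def osc_rank_def path_def)
next
  case False
  then obtain k where "a = Suc (2 * k)" by (metis oddE Suc_eq_plus1)
  then obtain j where "a = Suc (2 * Suc j)" using assms by (cases k) auto
  then show ?thesis by (simp add: path_val_def osc_rank_def path_def)
qed

text \<open>Pigeonhole on \<open>m\<close> disjoint levels.\<close>

lemma level_gap:
  assumes "finite Q" "card Q < m"
  shows "\<exists>i\<ge>a. i < a + m \<and> Q \<inter> {w i<..w (Suc i)} = {}"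
proof (rule ccontr)
  assume no_gap: "\<not> ?thesis"
  have "\<forall>i\<in>{a..<a + m}. \<exists>x. x \<in> Q \<inter> {w i<..w (Suc i)}"
  proof
    fix i assume "i \<in> {a..<a + m}"
    then have "Q \<inter> {w i<..w (Suc i)} \<noteq> {}" using no_gap by simp
    then show "\<exists>x. x \<in> Q \<inter> {w i<..w (Suc i)}" by blast
  qed
  then obtain g where g: "\<And>i. i \<in> {a..<a + m} \<Longrightarrow> g i \<in> Q \<inter> {w i<..w (Suc i)}" by metis
  have gl: "g i < g j" if "i \<in> {a..<a + m}" "j \<in> {a..<a + m}" "i < j" for i j
  proof -
    have "g i \<le> w (Suc i)" "w j < g j" using g that by auto
    moreover have "w (Suc i) \<le> w j" using that(3) by simp
    ultimately show ?thesis by linarith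
  qed
  have "inj_on g {a..<a + m}"
  proof (rule inj_onI)
    fix i j assume "i \<in> {a..<a + m}" "j \<in> {a..<a + m}" "g i = g j"
    then show "i = j" using gl[of i j] gl[of j i] by (cases i j rule: linorder_cases) auto
  qed
  moreover have "g ` {a..<a + m} \<subseteq> Q" using g by auto
  ultimately have "card {a..<a + m} \<le> card Q" using assms(1) by (intro card_inj_on_le[of g]) auto
  then show False using assms(2) by simp
qed

text \<open>A far level of \<open>\<pi>\<close> is cut off together with a stretch of the greedy path leading to it,
  and hung onto the greedy path near the root. On positions this is just the restriction
  of \<open>\<pi>\<close> to \<open>spliced\<close>; the one inversion linking the two path pieces is created by lowering the value
  at \<open>w\<^sub>r\<^sub>+\<^sub>1\<close> to just below that at \<open>u\<^sub>s\<close>.\<close>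

context
  fixes k0 s r :: nat
  assumes k0: "1 \<le> k0" "n0 \<le> w k0" "C \<subseteq> {..w k0}"
    and s: "s = k0 + b + 2" and r: "s < r"
begin

text \<open>Values are doubled so that an odd value is free just below that of
  \<open>u s\<close>.\<close>

definition splice_val :: "nat \<Rightarrow> nat" where
  "splice_val x = (if x = w (Suc r) then 2 * \<pi> (u s) - 1 else 2 * \<pi> x)"

text \<open>The path indices from \<open>u (k0 + 1)\<close> to \<open>w s\<close> and from
  \<open>u (r + 1)\<close> to \<open>w (r + b + 2)\<close>: \<open>b + 2\<close> pairs in each
  stretch, enough for \<open>b\<close> points to miss a level near either.\<close>

definition path_ids :: "nat set" where
  "path_ids = {2 * k0 + 2..2 * s + 1} \<union> {2 * r + 2..2 * (r + b) + 5}"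

definition spliced :: "nat set" where
  "spliced = {..w k0} \<union> path ` path_ids \<union> {w (r + b + 2)<..w (r + b + 3)}"

text \<open>Closes the gap between the two stretches, so that \<open>w (r + 1)\<close> takes the
  place of \<open>w (s + 1)\<close>.\<close>

definition pull :: "nat \<Rightarrow> nat" where
  "pull a = (if a \<le> 2 * s + 1 then a else a - 2 * (r - s))"

text \<open>Continues \<open>path_val\<close> across the splice with doubled values; place
  \<open>2 * s\<close>, that of \<open>w (s + 1)\<close>, goes to the lowered value at
  \<open>w (r + 1)\<close>.\<close>

definition splice_rank :: "nat \<Rightarrow> nat" where
  "splice_rank t = (if t = 2 * s then 2 * path_val (2 * s + 1) - 1
     else if t \<le> 2 * s + 1 then 2 * path_val t else 2 * path_val (t + 2 * (r - s)))"

lemma path_val_less: "path_val i < path_val j \<longleftrightarrow> i < j"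
  using path_val_strict_mono by (rule strict_mono_less)

lemma splice_rank_strict_mono: "strict_mono splice_rank"
  unfolding strict_mono_Suc_iff
proof
  fix t
  have lt: "path_val i < path_val j" if "i < j" for i j using that by (simp add: path_val_less)
  consider "Suc t < 2 * s" | "Suc t = 2 * s" | "t = 2 * s" | "t = 2 * s + 1" | "t \<ge> 2 * s + 2" by linarith
  then show "splice_rank t < splice_rank (Suc t)"
  proof cases
    case 1 then show ?thesis using lt[of t "Suc t"] by (simp add: splice_rank_def)
  next
    case 2 then show ?thesis using lt[of t "2 * s + 1"] by (simp add: splice_rank_def)
  next
    case 3 then show ?thesis using lt[of 0 "2 * s + 1"] by (simp add: splice_rank_def)
  next
    case 4 then show ?thesis using lt[of t "Suc t + 2 * (r - s)"] by (simp add: splice_rank_def)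
  next
    case 5 then show ?thesis using lt[of "t + 2 * (r - s)" "Suc t + 2 * (r - s)"] by (simp add: splice_rank_def)
  qed
qed

lemma path_ids_ge: "a \<in> path_ids \<Longrightarrow> 4 \<le> a"
  unfolding path_ids_def using k0(1) r s by auto

lemma splice_val_path:
  assumes "a \<in> path_ids" shows "splice_val (path a) = splice_rank (osc_rank (pull a))"
proof -
  have a4: "4 \<le> a" using path_ids_ge[OF assms] .
  have w_path: "w (Suc r) = path (2 * r + 3)" using path_odd[of "Suc r"] by (simp add: numeral_3_eq_3)
  have eq: "path a = w (Suc r) \<longleftrightarrow> a = 2 * r + 3" unfolding w_path using path_eq_iff[of a] a4 by simp
  consider "a \<le> 2 * s + 1" | "a = 2 * r + 3" | "2 * r + 2 \<le> a" "a \<noteq> 2 * r + 3"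
    using assms by (auto simp: path_ids_def)
  then show ?thesis
  proof cases
    case 1
    then have "osc_rank a \<le> 2 * s + 1"
      using le_neq_implies_less[of a "2 * s + 1"] by (auto simp: osc_rank_def)
    moreover have "osc_rank a \<noteq> 2 * s"
      using 1 a4 unfolding osc_rank_def by (cases "even a"; simp; presburger)
    ultimately show ?thesis using 1 eq r a4 pi_path[of a] by (simp add: splice_val_def splice_rank_def pull_def)
  next
    case 2
    then have "pull a = 2 * s + 3" using r by (auto simp: pull_def diff_mult_distrib2)
    then have "osc_rank (pull a) = 2 * s" by (simp add: osc_rank_def)
    moreover have "path_val (2 * s + 1) = \<pi> (u s)" by (simp add: path_val_def)
    ultimately show ?thesis using 2 w_path by (simp add: splice_val_def splice_rank_def)
  next
    case 3
    define a' where "a' = pull a"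
    have a': "a = a' + 2 * (r - s)" "2 * s + 2 \<le> a'" "a' \<noteq> 2 * s + 3"
      using 3 r by (auto simp: a'_def pull_def diff_mult_distrib2)
    have "3 \<le> a'" using a' s by linarith
    then have "osc_rank a = osc_rank a' + 2 * (r - s)" unfolding osc_rank_def a'(1) by auto
    moreover have "2 * s + 2 \<le> osc_rank a'"
    proof (cases "even a'")
      case False
      then have "a' \<noteq> 2 * s + 2" "a' \<noteq> 2 * s + 4" by auto
      then show ?thesis using a' False by (simp add: osc_rank_def)
    qed (use a' in \<open>simp add: osc_rank_def\<close>)
    ultimately show ?thesis using 3 eq a4 pi_path[of a] by (simp add: splice_val_def splice_rank_def a'_def[symmetric])
  qed
qed

lemma pull_less: "a \<in> path_ids \<Longrightarrow> a' \<in> path_ids \<Longrightarrow> a < a' \<Longrightarrow> pull a < pull a'"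
  using r by (auto simp: pull_def path_ids_def)

lemma pull_ge: "a \<in> path_ids \<Longrightarrow> 2 * k0 + 2 \<le> pull a"
  unfolding pull_def path_ids_def using r s by auto

text \<open>Through \<open>pull\<close> the spliced path has the order pattern of an uninterrupted
  stretch of the greedy path beyond \<open>w k0\<close>, where everything recurs.\<close>

lemma recurs_spliced_path: "recurs \<pi> splice_val (path ` path_ids)"
proof -
  have 1: "emb (\<lambda>a. splice_val (path a)) path_ids \<pi> (\<lambda>a. path (pull a))"
  proof (rule embI)
    fix a a' assume a: "a \<in> path_ids" "a' \<in> path_ids"
    have g: "3 \<le> pull a" "3 \<le> pull a'" using a[THEN pull_ge] k0(1) by simp_all
    show "path (pull a) < path (pull a')" if "a < a'"
      using pull_less[OF a that] g path_less by simp
    show "splice_val (path a) < splice_val (path a') \<longleftrightarrow> \<pi> (path (pull a)) < \<pi> (path (pull a'))"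
      using a g by (simp add: splice_val_path pi_path path_val_less strict_mono_less[OF splice_rank_strict_mono])
  qed
  have 2: "emb (\<lambda>a. splice_val (path a)) path_ids splice_val path"
    by (rule embI) (use path_ids_ge in \<open>force intro: path_less\<close>)+
  have "(\<lambda>a. path (pull a)) ` path_ids \<subseteq> {n0..}"
  proof (rule image_subsetI)
    fix a assume a: "a \<in> path_ids"
    have "path (Suc (2 * k0)) < path (pull a)" by (rule path_less) (use pull_ge[OF a] k0(1) in auto)
    then show "path (pull a) \<in> {n0..}" using k0(2) by simp
  qed
  then have "recurs \<pi> \<pi> ((\<lambda>a. path (pull a)) ` path_ids)" by (intro recurs_tail) (auto simp: path_ids_def)
  then have "recurs \<pi> (\<lambda>a. splice_val (path a)) path_ids" by (rule recurs_image[OF 1])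
  then show ?thesis
    using recurs_image[OF emb_inv[OF 2]] the_inv_into_onto[OF emb_inj_on[OF 2]] by simp
qed

text \<open>Keeps \<open>2 * \<pi> (u s) - 1\<close> odd despite truncated subtraction.\<close>

lemma u_s_pos: "0 < \<pi> (u s)"
  using le_peak[of "w s"] le_w[of s] s by (simp add: u_val)

lemma splice_val_inj: "inj_on splice_val A"
proof (rule inj_onI)
  fix x y assume e: "splice_val x = splice_val y"
  have odd: "2 * \<pi> (u s) - 1 \<noteq> 2 * n" for n using u_s_pos by presburger
  then show "x = y" using e odd[symmetric] by (auto simp: splice_val_def split: if_splits)
qed

text \<open>At most \<open>b\<close> points miss a level near each stretch. Before the first missed
  level the pattern is part of \<open>\<pi>\<close>, between the two it lies on the spliced path,
  after the second it lies in the tail. The last two parts recur and the three are in sum position,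
  so they can be joined.\<close>

lemma occurs_spliced: "occurs \<pi> splice_val spliced"
proof (rule occursI)
  show "finite spliced" by (simp add: spliced_def path_ids_def)
  show "inj_on splice_val spliced" by (rule splice_val_inj)
  fix Q assume Q: "Q \<subseteq> spliced" "finite Q" "card Q \<le> b"
  obtain i where i: "k0 \<le> i" "i < k0 + Suc b" "Q \<inter> {w i<..w (Suc i)} = {}"
    using level_gap[OF Q(2), of "Suc b" k0] Q(3) by auto
  obtain i' where i': "Suc r \<le> i'" "i' < Suc r + Suc b" "Q \<inter> {w i'<..w (Suc i')} = {}"
    using level_gap[OF Q(2), of "Suc b" "Suc r"] Q(3) by auto
  define Q1 Q2 Q3 where "Q1 = Q \<inter> {..w i}" and "Q2 = Q \<inter> {w (Suc i)<..w i'}" and "Q3 = Q \<inter> {w (Suc i')<..}"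
  have gap: "(x \<le> w i \<or> w (Suc i) < x) \<and> (x \<le> w i' \<or> w (Suc i') < x)" if "x \<in> Q" for x
    using i(3) i'(3) that unfolding disjoint_iff by (meson greaterThanAtMost_iff linorder_not_le)
  have Q_eq: "Q = (Q1 \<union> Q2) \<union> Q3"
  proof
    show "Q \<subseteq> (Q1 \<union> Q2) \<union> Q3"
    proof
      fix x assume "x \<in> Q"
      with gap[OF this] show "x \<in> (Q1 \<union> Q2) \<union> Q3" by (auto simp: Q1_def Q2_def Q3_def)
    qed
  qed (auto simp: Q1_def Q2_def Q3_def)
  have plain: "splice_val x = 2 * \<pi> x" if "x \<noteq> w (Suc r)" for x using that by (simp add: splice_val_def)
  have emb_plain: "emb splice_val B \<pi> (\<lambda>x. x)" if "w (Suc r) \<notin> B" for B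
    by (rule embI) (use that plain in \<open>auto simp: splice_val_def\<close>)
  have wi: "w i < w (Suc r)" using i(2) r s by simp
  have occ1: "occurs \<pi> splice_val Q1"
    unfolding occurs_def using emb_plain[of Q1] wi by (auto simp: Q1_def)
  have "Q2 \<subseteq> path ` path_ids"
  proof
    fix x assume "x \<in> Q2"
    then have x: "x \<in> spliced" "w (Suc i) < x" "x \<le> w i'" using Q(1) by (auto simp: Q2_def)
    have "w k0 < w (Suc i)" "w i' \<le> w (r + b + 2)" using i i' by simp_all
    then have "w k0 < x" "x \<le> w (r + b + 2)" using x by linarith+
    then show "x \<in> path ` path_ids" using x(1) by (auto simp: spliced_def)
  qed
  then have rec2: "recurs \<pi> splice_val Q2" by (rule recurs_subset[OF recurs_spliced_path])
  have wi': "w (Suc r) < w (Suc i')" "n0 \<le> w (Suc i')"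
  proof -
    show "w (Suc r) < w (Suc i')" using i'(1) by simp
    have "w k0 \<le> w (Suc i')" using i'(1) r s by simp
    then show "n0 \<le> w (Suc i')" using k0(2) le_trans by blast
  qed
  have "w (Suc r) \<notin> Q3" using wi'(1) by (auto simp: Q3_def)
  have rec3: "recurs \<pi> splice_val Q3"
  proof (rule recurs_image[OF emb_plain[OF \<open>w (Suc r) \<notin> Q3\<close>]], rule recurs_tail)
    show "(\<lambda>x. x) ` Q3 \<subseteq> {n0..}" using wi'(2) by (auto simp: Q3_def)
  qed (use Q(2) in \<open>simp add: Q3_def\<close>)
  have "occurs \<pi> splice_val (Q1 \<union> Q2)"
  proof (rule occurs_join[OF occ1 _ rec2])
    fix x y assume "x \<in> Q1" "y \<in> Q2"
    then have xy: "x \<le> w i" "w (Suc i) < y" by (auto simp: Q1_def Q2_def)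
    have "x \<noteq> w (Suc r)" using xy(1) wi by auto
    moreover have "\<pi> x < \<pi> y" using level_less xy by blast
    \<comment> \<open>Needed for \<open>y = w (Suc r)\<close>, whose lowered value is only just
      below that of \<open>u s\<close>.\<close>
    moreover have "\<pi> x < \<pi> (u s)"
    proof (rule level_less[OF xy(1)])
      have "w (Suc i) \<le> w (s - 1)" "w (s - 1) < u (Suc (s - 1))" using i(2) s u_Suc_gt by simp_all
      moreover have "Suc (s - 1) = s" using s by simp
      ultimately show "w (Suc i) < u s" by (metis le_less_trans)
    qed
    ultimately have "splice_val x < splice_val y" by (auto simp: splice_val_def)
    moreover have "w i < w (Suc i)" by simp
    ultimately show "x < y \<and> splice_val x < splice_val y" using xy by linarith
  qed (use Q(2) in \<open>simp add: Q1_def\<close>)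
  then have "occurs \<pi> splice_val ((Q1 \<union> Q2) \<union> Q3)"
  proof (rule occurs_join[OF _ _ rec3])
    fix x y assume Qxy: "x \<in> Q1 \<union> Q2" "y \<in> Q3"
    have "w i \<le> w i'" using i i' r s by simp
    then have "x \<le> w i'" using Qxy(1) le_trans[of x "w i" "w i'"] by (auto simp: Q1_def Q2_def)
    moreover have "w (Suc i') < y" "y \<noteq> w (Suc r)"
      using Qxy(2) \<open>w (Suc r) \<notin> Q3\<close> by (auto simp: Q3_def)
    ultimately have xy: "x \<le> w i'" "w (Suc i') < y" "y \<noteq> w (Suc r)" by blast+
    have "\<pi> x < \<pi> y" using level_less xy by blast
    moreover have "\<pi> (u s) < \<pi> y"
    proof (rule level_less[OF _ xy(2)])
      have "w s \<le> w i'" using i'(1) r by simp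
      then show "u s \<le> w i'" using u_le[of s] by linarith
    qed
    ultimately have "splice_val x < splice_val y" using xy(3) by (auto simp: splice_val_def)
    moreover have "w i' < w (Suc i')" by simp
    ultimately show "x < y \<and> splice_val x < splice_val y" using xy by linarith
  qed (use Q(2) in \<open>simp add: Q1_def Q2_def\<close>)
  then show "occurs \<pi> splice_val Q" using Q_eq by simp
qed

text \<open>In a copy of the spliced pattern \<open>C\<close> keeps the root below
  \<open>n0\<close>. From there \<open>s\<close> steps lead to \<open>w s\<close>, one through the
  lowered inversion to \<open>w (r + 1)\<close>, and \<open>b + 2\<close> to the end of the far
  level. The image of that end, and so the size of the level, is bounded independently of
  \<open>r\<close>.\<close>

lemma level_size: "w (r + b + 3) \<le> Suc (w (r + b + 2) + (reach \<pi> ^^ (s + b + 3)) n0)"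
proof -
  obtain f where f: "emb splice_val spliced \<pi> f" using occurs_spliced by (auto simp: occurs_def)
  have w_in: "w j \<in> spliced" if "j \<le> s \<or> r < j \<and> j \<le> r + b + 3" for j
  proof -
    consider "j \<le> k0" | "k0 < j" "j \<le> s" | "r < j" "j \<le> r + b + 2" | "j = r + b + 3"
      using \<open>j \<le> s \<or> r < j \<and> j \<le> r + b + 3\<close> by linarith
    then show ?thesis
    proof cases
      case 2
      then have "Suc (2 * j) \<in> path_ids" by (simp add: path_ids_def)
      then show ?thesis using imageI[of _ path_ids path] by (fastforce simp: spliced_def)
    next
      case 3
      then have "Suc (2 * j) \<in> path_ids" by (simp add: path_ids_def)
      then show ?thesis using imageI[of _ path_ids path] by (fastforce simp: spliced_def)
    qed (simp_all add: spliced_def)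
  qed
  have u_in: "u j \<in> spliced" if "j \<le> s \<or> r < j \<and> j \<le> r + b + 2" for j
  proof -
    consider "j \<le> k0" | "k0 < j" "j \<le> s" | "r < j" "j \<le> r + b + 2"
      using \<open>j \<le> s \<or> r < j \<and> j \<le> r + b + 2\<close> by linarith
    then show ?thesis
    proof cases
      case 1
      then have "w j \<le> w k0" by simp
      then have "u j \<le> w k0" using u_le[of j] by linarith
      then show ?thesis by (simp add: spliced_def)
    next
      case 2
      then have "2 * j \<in> path_ids" by (simp add: path_ids_def)
      then show ?thesis using imageI[of _ path_ids path] by (fastforce simp: spliced_def)
    next
      case 3
      then have "2 * j \<in> path_ids" by (simp add: path_ids_def)
      then show ?thesis using imageI[of _ path_ids path] by (fastforce simp: spliced_def)
    qed
  qed
  have w_inj: "w j = w (Suc r) \<longleftrightarrow> j = Suc r" for j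
    using w_strict_mono by (rule strict_mono_eq)
  have val: "splice_val (w (Suc j)) \<le> splice_val (u j)" if j: "j < s \<or> r < j" for j
  proof -
    have "w (Suc j) \<noteq> w (Suc r)" unfolding w_inj using j r by linarith
    moreover have "u j \<noteq> w (Suc r)"
    proof (cases "j < s")
      case True
      then have "w j < w (Suc r)" using r by simp
      then show ?thesis using u_le[of j] by linarith
    next
      case False
      then obtain l where l: "j = Suc l" "r \<le> l" using j by (cases j) auto
      show ?thesis
      proof (cases "r = l")
        case True
        then show ?thesis using l u_Suc_less[of l] by simp
      next
        case False
        then have "w (Suc r) \<le> w l" using l by simp
        then show ?thesis using u_Suc_gt[of l] unfolding l(1) by linarith
      qed
    qed
    ultimately show ?thesis using pi_w_Suc_le[of j] by (simp add: splice_val_def)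
  qed
  have "f c < n0"
  proof (rule emb_root_bounded[OF f _ _ _ recurs_tail])
    show "C \<subseteq> spliced" using k0(3) by (auto simp: spliced_def)
    show "c \<in> spliced" using w_in[of 0] by simp
    have "emb \<pi> C splice_val (\<lambda>x. x)"
    proof (rule embI)
      fix x y assume "x \<in> C" "y \<in> C"
      then have "x \<le> w k0" "y \<le> w k0" using k0(3) by auto
      moreover have "w k0 < w (Suc r)" using r s by simp
      ultimately have "x \<noteq> w (Suc r)" "y \<noteq> w (Suc r)" by auto
      then show "\<pi> x < \<pi> y \<longleftrightarrow> splice_val x < splice_val y" by (simp add: splice_val_def)
    qed
    then show "\<not> recurs \<pi> splice_val C" using recurs_image[of \<pi> C splice_val "\<lambda>x. x" \<pi>] C(3) by auto
  qed
  then have "f (w (0 + s)) \<le> (reach \<pi> ^^ s) n0"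
    by (intro emb_w_bound[OF nat_perm_axioms f]) (use w_in u_in val in auto)
  then have "reach \<pi> (f (w s)) \<le> (reach \<pi> ^^ Suc s) n0" by (simp add: reach_mono)
  \<comment> \<open>The artificial inversion: the lowered value at \<open>w (Suc r)\<close> is below
    that at \<open>u s\<close>.\<close>
  moreover have "f (w (Suc r)) \<le> reach \<pi> (f (w s))"
    by (rule emb_reach[OF f, of "u s"]) (use w_in[of s] w_in[of "Suc r"] u_in[of s] u_le[of s] w_inj[of s] r in
      \<open>auto simp: splice_val_def\<close>)
  ultimately have "f (w (Suc r)) \<le> (reach \<pi> ^^ Suc s) n0" by linarith
  then have "f (w (Suc r + (b + 2))) \<le> (reach \<pi> ^^ (b + 2)) ((reach \<pi> ^^ Suc s) n0)"
    by (intro emb_w_bound[OF nat_perm_axioms f]) (use w_in u_in val in auto)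
  also have "\<dots> = (reach \<pi> ^^ ((b + 2) + Suc s)) n0" by (simp only: funpow_add comp_apply)
  also have "(b + 2) + Suc s = s + b + 3" by simp
  finally have "f (w (Suc r + (b + 2))) \<le> (reach \<pi> ^^ (s + b + 3)) n0" .
  moreover have "Suc r + (b + 2) = r + b + 3" by simp
  ultimately have "f (w (r + b + 3)) \<le> (reach \<pi> ^^ (s + b + 3)) n0" by metis
  moreover have "w (r + b + 3) \<le> Suc (w (r + b + 2)) + f (w (r + b + 3))"
    by (rule emb_interval_length[OF f]) (auto simp: spliced_def)
  ultimately show ?thesis by simp
qed

end

lemma level_sizes_bounded: "\<exists>D k0. \<forall>k\<ge>k0. w (Suc k) \<le> w k + D"
proof -
  obtain k1 where k1: "\<And>j. k1 \<le> j \<Longrightarrow> C \<subseteq> {..w j}" using C_subset by blast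
  define k0 where "k0 = Suc (k1 + n0)"
  define s where "s = k0 + b + 2"
  have k0: "1 \<le> k0" "n0 \<le> w k0" "C \<subseteq> {..w k0}"
    using le_w[of k0] k1[of k0] by (simp_all add: k0_def)
  have "w (Suc k) \<le> w k + Suc ((reach \<pi> ^^ (s + b + 3)) n0)" if "s + b + 3 \<le> k" for k
  proof -
    obtain r where r: "k = r + b + 2"
      using le_Suc_ex[of "b + 2" k] \<open>s + b + 3 \<le> k\<close> by (auto simp: algebra_simps)
    then have "w (r + b + 3) \<le> Suc (w (r + b + 2) + (reach \<pi> ^^ (s + b + 3)) n0)"
      using that by (intro level_size[OF k0 s_def]) simp
    moreover have "Suc k = r + b + 3" using r by simp
    ultimately show ?thesis using r by (simp only: add_Suc_right)
  qed
  then show ?thesis by blast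
qed

end

section \<open>Periodicity\<close>

lemma emb_atMost_fixed:
  assumes "emb p {..m} q f" "f m = m" "i \<le> m" shows "f i = i"
proof -
  have "f (m - t) + t \<le> m" if "t \<le> m" for t
    using that
  proof (induction t)
    case (Suc t)
    then have "f (m - Suc t) < f (m - t)"
      using emb_less[OF assms(1), of "m - Suc t" "m - t"] by simp
    then show ?case using Suc by simp
  qed (simp add: assms(2))
  from this[of "m - i"] assms(3) emb_increasing_atMost[OF assms(1,3)] show ?thesis by simp
qed

lemma (in nat_perm) peak_le_reach: "peak \<pi> n \<le> reach \<pi> n"
proof -
  have "{..peak \<pi> n} \<subseteq> \<pi> ` {..reach \<pi> n}"
  proof
    fix v assume "v \<in> {..peak \<pi> n}"
    moreover obtain i where "\<pi> i = v" using surj_ex by blast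
    ultimately show "v \<in> \<pi> ` {..reach \<pi> n}" using le_reachI by auto
  qed
  then have "card {..peak \<pi> n} \<le> card (\<pi> ` {..reach \<pi> n})" by (rule card_mono[rotated]) simp
  then show ?thesis by (simp add: card_image[OF inj_on])
qed

lemma (in nat_perm) card_below: "card {m. \<pi> m < \<pi> n} = \<pi> n"
proof -
  have "card (\<pi> -` {..<\<pi> n}) = card {..<\<pi> n}"
    by (rule card_vimage_inj) (use bij in \<open>auto simp: bij_def\<close>)
  moreover have "\<pi> -` {..<\<pi> n} = {m. \<pi> m < \<pi> n}" by auto
  ultimately show ?thesis by simp
qed

section \<open>Repeating windows and transplanted tails\<close>

context rooted_perm
begin

text \<open>Agreement relative to \<open>w k\<close> and \<open>w l\<close>, stated additively to
  avoid truncated subtraction. Values are compared past the first of the \<open>b + 2\<close>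
  levels; the remaining \<open>b + 1\<close> suffice for \<open>b\<close> points to miss
  one.\<close>

definition same_window :: "nat \<Rightarrow> nat \<Rightarrow> bool" where
  "same_window k l \<longleftrightarrow>
     (\<forall>t\<le>b + 2. w (k + t) + w l = w (l + t) + w k \<and>
        peak \<pi> (w (k + t)) + w l = peak \<pi> (w (l + t)) + w k) \<and>
     (\<forall>x. w (Suc k) < w k + x \<and> w k + x \<le> w (k + (b + 2)) \<longrightarrow> \<pi> (w k + x) + w l = \<pi> (w l + x) + w k)"

lemma w_le_pi: "w (Suc k) < n \<Longrightarrow> w k \<le> \<pi> n"
  using peak_less[of "w k" n] le_peak[of "w k"] by (simp add: w_Suc)

text \<open>With bounded levels a window has only finitely many states relative to its start, so
  some state repeats.\<close>

lemma same_window_exists: "\<exists>k l. K \<le> k \<and> k < l \<and> same_window k l"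
proof -
  obtain D k0 where D: "\<And>k. k0 \<le> k \<Longrightarrow> w (Suc k) \<le> w k + D" using level_sizes_bounded by blast
  \<comment> \<open>Peaks in the window are bounded by the end of one further level, hence
    \<open>b + 3\<close>.\<close>
  let ?h = "b + 2" and ?B = "(b + 3) * D"
  define state where "state k = (map (\<lambda>t. w (k + t) - w k) [0..<Suc ?h],
    map (\<lambda>t. peak \<pi> (w (k + t)) - w k) [0..<Suc ?h],
    map (\<lambda>x. \<pi> (w k + x) - w k) [0..<Suc (w (k + ?h) - w k)])" for k
  let ?L = "{xs. set xs \<subseteq> {..?B} \<and> length xs \<le> ?B + ?h + 1}"
  have w_bound: "w (k + t) \<le> w k + t * D" if "k0 \<le> k" for k t
  proof (induction t)
    case (Suc t)
    then show ?case using D[of "k + t"] that by simp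
  qed simp
  have w_bound': "w (k + t) \<le> w k + ?B" if "k0 \<le> k" "t \<le> ?h + 1" for k t
  proof -
    have "t * D \<le> ?B" using that(2) by (intro mult_right_mono) simp_all
    then show ?thesis using w_bound[OF that(1), of t] by linarith
  qed
  have peak_bound: "peak \<pi> (w (k + t)) \<le> w k + ?B" if "k0 \<le> k" "t \<le> ?h" for k t
    using peak_le_reach[of "w (k + t)"] w_bound'[OF that(1), of "Suc t"] that(2) by (simp add: w_Suc)
  have state_in: "state k \<in> ?L \<times> ?L \<times> ?L" if "k0 \<le> k" for k
  proof -
    have 1: "w (k + t) - w k \<le> ?B" if "t < Suc ?h" for t
      using w_bound'[OF \<open>k0 \<le> k\<close>, of t] that by linarith
    have 2: "peak \<pi> (w (k + t)) - w k \<le> ?B" if "t < Suc ?h" for t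
      using peak_bound[OF \<open>k0 \<le> k\<close>, of t] that by linarith
    have 3: "\<pi> (w k + x) - w k \<le> ?B" if "x < Suc (w (k + ?h) - w k)" for x
    proof -
      have "w k \<le> w (k + ?h)" by simp
      then have "w k + x \<le> w (k + ?h)" using that by linarith
      then have "\<pi> (w k + x) \<le> peak \<pi> (w (k + ?h))" by (rule peak_ge)
      then show ?thesis using peak_bound[OF \<open>k0 \<le> k\<close>, of ?h] by linarith
    qed
    have L: "map g [0..<m] \<in> ?L" if "\<And>t. t < m \<Longrightarrow> g t \<le> ?B" "m \<le> ?B + ?h + 1" for g m
      using that by auto
    have "Suc (w (k + ?h) - w k) \<le> ?B + ?h + 1" using 1[of ?h] by linarith
    moreover have "Suc ?h \<le> ?B + ?h + 1" by linarith
    ultimately show ?thesis unfolding state_def by (intro SigmaI L 1 2 3)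
  qed
  have "state ` {max k0 K..} \<subseteq> ?L \<times> ?L \<times> ?L"
    by (rule image_subsetI, rule state_in) simp
  moreover have "finite (?L \<times> ?L \<times> ?L)" by (intro finite_cartesian_product finite_lists_length_le) simp_all
  ultimately have "finite (state ` {max k0 K..})" by (rule finite_subset)
  then obtain k where k: "k \<in> {max k0 K..}" "infinite {l \<in> {max k0 K..}. state l = state k}"
    using pigeonhole_infinite[OF infinite_Ici] by blast
  then obtain l where l: "k < l" "state l = state k"
    unfolding finite_nat_set_iff_bounded_le by (auto simp: not_le)
  have eqs: "w (k + t) - w k = w (l + t) - w l" "peak \<pi> (w (k + t)) - w k = peak \<pi> (w (l + t)) - w l"
    if "t \<le> ?h" for t
    using l(2) that unfolding state_def by (auto simp del: upt_Suc)
  have len: "w (k + ?h) - w k = w (l + ?h) - w l" using eqs(1)[of ?h] by simp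
  have vals: "\<pi> (w k + x) - w k = \<pi> (w l + x) - w l" if "x \<le> w (k + ?h) - w k" for x
    using l(2) that len unfolding state_def by (auto simp del: upt_Suc)
  have "same_window k l"
    unfolding same_window_def
  proof (intro conjI allI impI)
    fix t assume t: "t \<le> ?h"
    have "w k \<le> w (k + t)" "w l \<le> w (l + t)" by simp_all
    then show "w (k + t) + w l = w (l + t) + w k" using eqs(1)[OF t] by linarith
    then show "peak \<pi> (w (k + t)) + w l = peak \<pi> (w (l + t)) + w k"
      using eqs(2)[OF t] le_peak[of "w (k + t)"] le_peak[of "w (l + t)"] \<open>w k \<le> w (k + t)\<close> \<open>w l \<le> w (l + t)\<close>
      by linarith
  next
    fix x assume x: "w (Suc k) < w k + x \<and> w k + x \<le> w (k + ?h)"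
    have "w (Suc k) - w k = w (Suc l) - w l" using eqs(1)[of 1] by simp
    moreover have "w k < w (Suc k)" "w l < w (Suc l)" by simp_all
    ultimately have "w (Suc l) < w l + x" using x by linarith
    \<comment> \<open>Past the first level values are at least \<open>w k\<close> and
      \<open>w l\<close> respectively, so the truncated differences in \<open>state\<close>
      determine them.\<close>
    then show "\<pi> (w k + x) + w l = \<pi> (w l + x) + w k"
      using vals[of x] x w_le_pi[of k "w k + x"] w_le_pi[of l "w l + x"] by linarith
  qed
  then show ?thesis using k(1) l(1) by auto
qed

lemma same_window_sym: "same_window k l \<Longrightarrow> same_window l k"
  unfolding same_window_def
proof (elim conjE, intro conjI allI impI)
  assume a: "\<forall>t\<le>b + 2. w (k + t) + w l = w (l + t) + w k \<and> peak \<pi> (w (k + t)) + w l = peak \<pi> (w (l + t)) + w k"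
    and v: "\<forall>x. w (Suc k) < w k + x \<and> w k + x \<le> w (k + (b + 2)) \<longrightarrow> \<pi> (w k + x) + w l = \<pi> (w l + x) + w k"
  show "w (l + t) + w k = w (k + t) + w l" "peak \<pi> (w (l + t)) + w k = peak \<pi> (w (k + t)) + w l"
    if "t \<le> b + 2" for t using a that by simp_all
  fix x assume x: "w (Suc l) < w l + x \<and> w l + x \<le> w (l + (b + 2))"
  have "w (Suc k) + w l = w (Suc l) + w k" "w (k + (b + 2)) + w l = w (l + (b + 2)) + w k"
    using a[rule_format, of 1] a[rule_format, of "b + 2"] by simp_all
  then have "w (Suc k) < w k + x \<and> w k + x \<le> w (k + (b + 2))" using x by linarith
  then show "\<pi> (w l + x) + w k = \<pi> (w k + x) + w l" using v by simp
qed

text \<open>If the windows at \<open>w\<^sub>k\<close> and \<open>w\<^sub>l\<close> look alike, the tail of \<open>\<pi>\<close> after \<open>w\<^sub>l\<close> can be transplanted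
  to \<open>w\<^sub>k\<close>, for \<open>k < l\<close> as well as for \<open>k > l\<close>. Rigidity at the root makes the levels of \<open>\<pi>\<close>
  at least as long as those of the transplant, so the two transplants together force equality.\<close>

context
  fixes k l :: nat
  assumes win: "same_window k l"
    and far: "n0 \<le> w l"
    and root: "\<And>f. emb \<pi> {..w k} \<pi> f \<Longrightarrow> f c = c"
begin

text \<open>Keeps \<open>\<pi>\<close> through the window at \<open>k\<close>, then continues with
  the tail after the window at \<open>l\<close>. On the window past \<open>w (Suc k)\<close> both
  descriptions agree.\<close>

definition transplant :: "nat \<Rightarrow> nat" where
  "transplant n = (if n \<le> w (k + (b + 2)) then \<pi> n else \<pi> (n - w k + w l) - w l + w k)"

text \<open>Level ends of \<open>\<pi>\<close> up to \<open>k\<close>, then those following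
  \<open>w l\<close>, shifted to start at \<open>w k\<close>.\<close>

definition level_end :: "nat \<Rightarrow> nat" where
  "level_end j = (if j \<le> k then w j else w (l + (j - k)) - w l + w k)"

lemma win_w: "t \<le> b + 2 \<Longrightarrow> w (k + t) + w l = w (l + t) + w k"
  and win_peak: "t \<le> b + 2 \<Longrightarrow> peak \<pi> (w (k + t)) + w l = peak \<pi> (w (l + t)) + w k"
  and win_val: "w (Suc k) < w k + x \<Longrightarrow> w k + x \<le> w (k + (b + 2)) \<Longrightarrow> \<pi> (w k + x) + w l = \<pi> (w l + x) + w k"
  using win unfolding same_window_def by blast+

lemma transplant_before: "n \<le> w (k + (b + 2)) \<Longrightarrow> transplant n = \<pi> n"
  by (simp add: transplant_def)

lemma transplant_after:
  assumes "w (Suc k) < n" shows "transplant n + w l = \<pi> (n - w k + w l) + w k"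
proof -
  have k: "w k < n" using assms w_less_Suc[of k] by linarith
  show ?thesis
  proof (cases "n \<le> w (k + (b + 2))")
    case True
    then show ?thesis using win_val[of "n - w k"] assms k by (simp add: transplant_def add.commute)
  next
    case False
    have "w (Suc k) + w l = w (Suc l) + w k" using win_w[of 1] by simp
    then have "w (Suc l) < n - w k + w l" using assms k by linarith
    then have "w l \<le> \<pi> (n - w k + w l)" by (rule w_le_pi)
    moreover have "transplant n = \<pi> (n - w k + w l) - w l + w k"
      using False unfolding transplant_def by (rule if_not_P)
    ultimately show ?thesis by linarith
  qed
qed

lemma emb_transplant_before: "B \<subseteq> {..w (k + (b + 2))} \<Longrightarrow> emb transplant B \<pi> (\<lambda>i. i)"
  by (rule embI) (auto simp: transplant_def)

lemma emb_transplant_after: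
  assumes "B \<subseteq> {w (Suc k)<..}" shows "emb transplant B \<pi> (\<lambda>n. n - w k + w l)"
proof (rule embI)
  fix i j assume "i \<in> B" "j \<in> B"
  then have ij: "w (Suc k) < i" "w (Suc k) < j" using assms by auto
  then have k: "w k < i" using w_less_Suc[of k] by linarith
  show "i - w k + w l < j - w k + w l" if "i < j" using that k by linarith
  show "transplant i < transplant j \<longleftrightarrow> \<pi> (i - w k + w l) < \<pi> (j - w k + w l)"
    using transplant_after[OF ij(1)] transplant_after[OF ij(2)] by linarith
qed

lemma transplant_level_less:
  assumes "Suc i \<le> b + 2" "x \<le> w (k + i)" "w (Suc (k + i)) < y" "1 \<le> i"
  shows "transplant x < transplant y"
proof -
  have "w (k + i) \<le> w (k + (b + 2))" using assms(1) by simp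
  then have "x \<le> w (k + (b + 2))" using assms(2) by linarith
  then have x: "transplant x \<le> peak \<pi> (w (k + i))"
    using peak_ge[OF assms(2)] by (simp add: transplant_def)
  have "w (Suc k) \<le> w (Suc (k + i))" "w k \<le> w (Suc (k + i))" by simp_all
  then have y: "w (Suc k) < y" "w k < y" using assms(3) by linarith+
  have "w (Suc (k + i)) + w l = w (Suc (l + i)) + w k" using win_w[of "Suc i"] assms(1) by simp
  then have "w (Suc (l + i)) < y - w k + w l" using assms(3) y(2) by linarith
  then have "peak \<pi> (w (l + i)) < \<pi> (y - w k + w l)" by (intro peak_less) (simp add: w_Suc)
  then show ?thesis using x transplant_after[OF y(1)] win_peak[of i] assms(1) by linarith
qed

lemma transplant_inj_on: "inj_on transplant A"
proof -
  have less: "transplant x \<noteq> transplant y" if "x < y" for x y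
  proof -
    consider "y \<le> w (k + (b + 2))" | "w (Suc k) < x" | "x \<le> w (k + 1)" "w (k + (b + 2)) < y"
      by fastforce
    then show ?thesis
    proof cases
      case 1
      then show ?thesis using that by (simp add: transplant_def)
    next
      case 2
      moreover have "w k < w (Suc k)" by simp
      ultimately have "x - w k + w l \<noteq> y - w k + w l" using that by linarith
      then have "\<pi> (x - w k + w l) \<noteq> \<pi> (y - w k + w l)" by (simp only: eq_iff) simp
      moreover have "w (Suc k) < y" using 2 that by linarith
      ultimately show ?thesis using transplant_after[OF 2] transplant_after[of y] by linarith
    next
      case 3
      have "w (Suc (k + 1)) \<le> w (k + (b + 2))" by simp
      then have "transplant x < transplant y" by (intro transplant_level_less[of 1]) (use 3 in linarith)+
      then show ?thesis by simp
    qed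
  qed
  show ?thesis
  proof (rule inj_onI)
    fix x y assume "transplant x = transplant y"
    then show "x = y" using less[of x y] less[of y x] by (cases x y rule: linorder_cases) auto
  qed
qed

text \<open>At most \<open>b\<close> points miss one of the \<open>b + 1\<close> levels after
  \<open>w (Suc k)\<close>. Before it the transplant is \<open>\<pi>\<close>, after it a shifted
  piece of the recurring tail, so the two parts can be joined.\<close>

lemma occurs_transplant: "occurs \<pi> transplant {..m}"
proof (rule occursI)
  fix Q assume Q: "Q \<subseteq> {..m}" "finite Q" "card Q \<le> b"
  obtain j where j: "Suc k \<le> j" "j < Suc k + Suc b" "Q \<inter> {w j<..w (Suc j)} = {}"
    using level_gap[OF Q(2), of "Suc b" "Suc k"] Q(3) by auto
  obtain i where i: "j = k + i" "1 \<le> i" "Suc i \<le> b + 2"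
    using j(1,2) le_Suc_ex[of k j] by auto
  define Q1 Q2 where "Q1 = Q \<inter> {..w j}" and "Q2 = Q \<inter> {w (Suc j)<..}"
  have gap: "x \<le> w j \<or> w (Suc j) < x" if "x \<in> Q" for x
    using j(3) that unfolding disjoint_iff by (meson greaterThanAtMost_iff linorder_not_le)
  have Q_eq: "Q = Q1 \<union> Q2" using gap by (auto simp: Q1_def Q2_def)
  have "w j \<le> w (k + (b + 2))" using i by simp
  then have "emb transplant Q1 \<pi> (\<lambda>i. i)"
    by (intro emb_transplant_before) (auto simp: Q1_def simp del: w_le_iff)
  then have occ: "occurs \<pi> transplant Q1" by (auto simp: occurs_def)
  have "w (Suc k) < w (Suc j)" using j(1) by simp
  then have "Q2 \<subseteq> {w (Suc k)<..}" by (auto simp: Q2_def simp del: w_less_iff)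
  then have "emb transplant Q2 \<pi> (\<lambda>n. n - w k + w l)" by (rule emb_transplant_after)
  moreover have "recurs \<pi> \<pi> ((\<lambda>n. n - w k + w l) ` Q2)"
    by (rule recurs_tail) (use Q(2) far in \<open>auto simp: Q2_def\<close>)
  ultimately have rec: "recurs \<pi> transplant Q2" by (rule recurs_image)
  have "occurs \<pi> transplant (Q1 \<union> Q2)"
  proof (rule occurs_join[OF occ _ rec])
    fix x y assume "x \<in> Q1" "y \<in> Q2"
    then have xy: "x \<le> w (k + i)" "w (Suc (k + i)) < y" by (auto simp: Q1_def Q2_def i(1))
    moreover have "w (k + i) < w (Suc (k + i))" by simp
    ultimately show "x < y \<and> transplant x < transplant y"
      using transplant_level_less[OF i(3) xy i(2)] by linarith
  qed (use Q(2) in \<open>simp add: Q1_def\<close>)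
  then show "occurs \<pi> transplant Q" using Q_eq by simp
qed (simp_all add: transplant_inj_on)

lemma level_end_after: "level_end (k + t) + w l = w (l + t) + w k"
proof (cases "t = 0")
  case False
  have "w l \<le> w (l + t)" by simp
  moreover have "level_end (k + t) = w (l + t) - w l + w k" using False by (simp add: level_end_def)
  ultimately show ?thesis by linarith
qed (simp add: level_end_def)

lemma level_end_before: assumes "j \<le> k + (b + 2)" shows "level_end j = w j"
proof (cases "j \<le> k")
  case False
  then obtain t where t: "j = k + t" using le_Suc_ex[of k j] by auto
  then show ?thesis using level_end_after[of t] win_w[of t] assms by simp
qed (simp add: level_end_def)

lemma level_end_mono: "i \<le> j \<Longrightarrow> level_end i \<le> level_end j"
proof (induction j rule: dec_induct)
  case (step j)
  have "level_end j \<le> level_end (Suc j)"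
  proof (cases "j < k")
    case False
    then obtain t where t: "j = k + t" using le_Suc_ex[of k j] by auto
    have "w (l + t) \<le> w (l + Suc t)" by simp
    then have "level_end (k + t) \<le> level_end (k + Suc t)"
      using level_end_after[of t] level_end_after[of "Suc t"] by linarith
    then show ?thesis using t by simp
  qed (simp add: level_end_def)
  then show ?case using step by linarith
qed simp

text \<open>The inversion leading from one level end to the next survives in the transplant,
  unchanged inside the window and as a shifted copy beyond it.\<close>

lemma level_end_step:
  "\<exists>a\<le>level_end j. transplant (level_end (Suc j)) \<le> transplant a"
proof (cases "Suc j \<le> k + (b + 2)")
  case True
  then have "w j \<le> w (k + (b + 2))" "w (Suc j) \<le> w (k + (b + 2))" by simp_all
  then have "transplant (w (Suc j)) \<le> transplant (u j)"
    using u_le[of j] pi_w_Suc_le[of j] by (simp add: transplant_before del: w_le_iff)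
  then show ?thesis using True u_le[of j] level_end_before by auto
next
  case False
  then have "k \<le> j" "k + 2 \<le> j" by simp_all
  then obtain t where t: "j = k + Suc (Suc t)" using le_Suc_ex[of "k + 2" j] by auto
  \<comment> \<open>The shifted peak; being at least two levels past \<open>l\<close> puts it beyond
    \<open>w (Suc k)\<close>, where the shifted description is valid.\<close>
  define a where "a = u (l + Suc (Suc t)) - w l + w k"
  have "w (Suc l) \<le> w (l + Suc t)" "w l \<le> w (Suc l)" by simp_all
  moreover have "w (l + Suc t) < u (l + Suc (Suc t))" using u_Suc_gt[of "l + Suc t"] by simp
  moreover have wS: "w (Suc k) + w l = w (Suc l) + w k" using win_w[of 1] by simp
  ultimately have a: "a + w l = u (l + Suc (Suc t)) + w k" "w (Suc k) < a" "w k \<le> a"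
    unfolding a_def by linarith+
  have e: "level_end (Suc j) + w l = w (Suc (l + Suc (Suc t))) + w k"
    using level_end_after[of "Suc (Suc (Suc t))"] t by simp
  moreover have "w (Suc l) < w (Suc (l + Suc (Suc t)))" "w k \<le> w (Suc k)" by simp_all
  ultimately have e': "w (Suc k) < level_end (Suc j)" "w k \<le> level_end (Suc j)" using wS by linarith+
  have shift: "a - w k + w l = u (l + Suc (Suc t))" "level_end (Suc j) - w k + w l = w (Suc (l + Suc (Suc t)))"
    using a e e' by linarith+
  have "transplant (level_end (Suc j)) \<le> transplant a"
    using transplant_after[OF a(2), unfolded shift] transplant_after[OF e'(1), unfolded shift]
      pi_w_Suc_le[of "l + Suc (Suc t)"] by linarith
  moreover have "a \<le> level_end j"
    using level_end_after[of "Suc (Suc t)"] a(1) u_le[of "l + Suc (Suc t)"] unfolding t by linarith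
  ultimately show ?thesis by blast
qed

text \<open>Up to \<open>w k\<close> the embedding is one of \<open>\<pi>\<close> into itself, so it
  fixes \<open>c\<close> by \<open>root\<close>; each further level end costs at most one
  \<open>reach\<close>.\<close>

lemma transplant_emb_level_end:
  assumes f: "emb transplant {..level_end N} \<pi> f" and "k \<le> N" "j \<le> N"
  shows "f (level_end j) \<le> w j"
  using assms(3)
proof (induction j)
  case 0
  have kN: "w k \<le> level_end N" using level_end_mono[OF assms(2)] by (simp add: level_end_def)
  have "emb \<pi> {..w k} transplant (\<lambda>i. i)"
  proof (rule embI)
    fix i j assume ij: "i \<in> {..w k}" "j \<in> {..w k}"
    have "w k \<le> w (k + (b + 2))" by simp
    then have "i \<le> w (k + (b + 2))" "j \<le> w (k + (b + 2))" using ij unfolding atMost_iff by linarith+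
    then have "transplant i = \<pi> i" "transplant j = \<pi> j" by (simp_all only: transplant_before)
    then show "\<pi> i < \<pi> j \<longleftrightarrow> transplant i < transplant j" by simp
  qed
  moreover have "emb transplant ((\<lambda>i. i) ` {..w k}) \<pi> f" by (rule emb_subset[OF f]) (use kN in auto)
  ultimately have "emb \<pi> {..w k} \<pi> f" by (rule emb_comp)
  then have "f c = c" by (rule root)
  then show ?case by (simp add: level_end_def)
next
  case (Suc j)
  obtain a where a: "a \<le> level_end j" "transplant (level_end (Suc j)) \<le> transplant a"
    using level_end_step by blast
  have "f (level_end (Suc j)) \<le> reach \<pi> (f (level_end j))"
    by (rule emb_reach[OF f, of a]) (use a level_end_mono[of j N] level_end_mono[of "Suc j" N] Suc.prems in auto)
  also have "\<dots> \<le> reach \<pi> (w j)" using Suc by (intro reach_mono) simp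
  finally show ?case by (simp add: w_Suc)
qed

text \<open>Embeddings of initial segments never move positions to the left, so
  \<open>level_end (k + t)\<close> is at most its image and hence at most
  \<open>w (k + t)\<close>.\<close>

lemma transplant_levels_le: "w (l + t) + w k \<le> w (k + t) + w l"
proof -
  obtain f where f: "emb transplant {..level_end (k + t)} \<pi> f" using occurs_transplant by (auto simp: occurs_def)
  have "level_end (k + t) \<le> f (level_end (k + t))" using emb_increasing_atMost[OF f] by simp
  also have "\<dots> \<le> w (k + t)" using transplant_emb_level_end[OF f] by simp
  finally show ?thesis using level_end_after[of t] by linarith
qed

text \<open>With equal levels the embedding of a long segment fixes its last position, hence all
  earlier ones, so it is an identity preserving order.\<close>

lemma transplant_order:
  assumes eq: "\<And>t. w (l + t) + w k = w (k + t) + w l"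
  shows "transplant i < transplant j \<longleftrightarrow> \<pi> i < \<pi> j"
proof -
  define N where "N = k + (i + j)"
  obtain f where f: "emb transplant {..level_end N} \<pi> f" using occurs_transplant by (auto simp: occurs_def)
  have e: "level_end N = w N" using level_end_after[of "i + j"] eq[of "i + j"] by (simp add: N_def)
  have "level_end N \<le> f (level_end N)" using emb_increasing_atMost[OF f] by simp
  moreover have "f (level_end N) \<le> w N" using transplant_emb_level_end[OF f] by (simp add: N_def)
  ultimately have fN: "f (level_end N) = level_end N" using e by simp
  have "i \<le> level_end N" "j \<le> level_end N" using le_w[of N] unfolding e by (simp_all add: N_def)
  then show ?thesis
    using emb_val_less[OF f, of i j] emb_atMost_fixed[OF f fN, of i] emb_atMost_fixed[OF f fN, of j] by simp
qed

lemma order_periodic: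
  assumes eq: "\<And>t. w (l + t) + w k = w (k + t) + w l" and "w (Suc k) < i" "w (Suc k) < j"
  shows "\<pi> (i - w k + w l) < \<pi> (j - w k + w l) \<longleftrightarrow> \<pi> i < \<pi> j"
  using transplant_order[OF eq, of i j] transplant_after[OF assms(2)] transplant_after[OF assms(3)] by linarith

end

text \<open>Transplanting in both directions makes the level lengths from \<open>k\<close> and from
  \<open>l\<close> equal, so the order is periodic beyond \<open>w (Suc k)\<close>. As a value
  counts the smaller values, exact periodicity follows.\<close>

lemma periodic: "\<exists>P>0. \<exists>N. \<forall>n\<ge>N. \<pi> (n + P) = \<pi> n + P"
proof -
  obtain k1 where k1: "\<And>f. emb \<pi> {..w k1} \<pi> f \<Longrightarrow> f c = c" using root_fixed by blast
  obtain k l where kl: "k1 + n0 \<le> k" "k < l" "same_window k l" using same_window_exists by blast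
  have root: "f c = c" if "emb \<pi> {..w j} \<pi> f" "k \<le> j" for f j
    by (rule k1, rule emb_subset[OF that(1)]) (use kl(1) that(2) in simp)
  have far: "n0 \<le> w j" if "k \<le> j" for j using le_w[of j] kl(1) that by linarith
  have le1: "w (l + t) + w k \<le> w (k + t) + w l" for t
    by (rule transplant_levels_le[OF kl(3) far]) (use root kl(2) in auto)
  have le2: "w (k + t) + w l \<le> w (l + t) + w k" for t
    by (rule transplant_levels_le[OF same_window_sym[OF kl(3)] far]) (use root kl(2) in auto)
  have eq: "w (l + t) + w k = w (k + t) + w l" for t using le1 le2 by (rule le_antisym)
  define P where "P = w l - w k"
  have P: "0 < P" "w l = w k + P" using kl(2) w_less_iff[of k l] by (simp_all add: P_def)
  let ?x = "w (Suc k)"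
  have wk: "w k < ?x" by simp
  have ord: "\<pi> (i + P) < \<pi> (j + P) \<longleftrightarrow> \<pi> i < \<pi> j" if "?x < i" "?x < j" for i j
  proof -
    have "i - w k + w l = i + P" "j - w k + w l = j + P" using that wk P by linarith+
    then show ?thesis using order_periodic[OF kl(3) far _ eq that] root kl(2) by simp
  qed
  \<comment> \<open>Beyond \<open>w (k + 2)\<close> all positions up to \<open>w (k + 1)\<close>
    carry smaller values. The same holds after the shift, which adds exactly \<open>P\<close> to
    this part of the count.\<close>
  have "\<pi> (n + P) = \<pi> n + P" if n: "Suc (w (Suc (Suc k))) \<le> n" for n
  proof -
    have xn: "w (Suc (Suc k)) < n" "?x < n" using n w_less_Suc[of "Suc k"] by linarith+
    let ?S = "{m. ?x < m \<and> \<pi> m < \<pi> n}"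
    have fin: "finite ?S" by (rule finite_subset[OF _ finite_le[of "\<pi> n"]]) auto
    have "{m. \<pi> m < \<pi> n} = {..?x} \<union> ?S"
      using level_less[OF _ xn(1)] by auto
    then have "card {m. \<pi> m < \<pi> n} = card {..?x} + card ?S"
      using fin by (simp add: card_Un_disjoint disjoint_iff)
    then have 1: "\<pi> n = Suc ?x + card ?S" by (simp add: card_below)
    have x': "?x + P = w (Suc l)" "w (Suc (Suc k)) + P = w (Suc (Suc l))"
      using eq[of 1] eq[of 2] P by simp_all
    have "{m. \<pi> m < \<pi> (n + P)} = {..?x + P} \<union> (\<lambda>m. m + P) ` ?S"
    proof (intro equalityI subsetI)
      fix m assume m: "m \<in> {m. \<pi> m < \<pi> (n + P)}"
      show "m \<in> {..?x + P} \<union> (\<lambda>m. m + P) ` ?S"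
      proof (cases "m \<le> ?x + P")
        case False
        then have "m = (m - P) + P" "?x < m - P" by linarith+
        moreover have "\<pi> (m - P) < \<pi> n" using m ord[of "m - P" n] calculation xn(2) by simp
        ultimately show ?thesis by blast
      qed simp
    next
      fix m assume "m \<in> {..?x + P} \<union> (\<lambda>m. m + P) ` ?S"
      then show "m \<in> {m. \<pi> m < \<pi> (n + P)}"
      proof
        assume "m \<in> {..?x + P}"
        then have "m \<le> w (Suc l)" using x'(1) by simp
        moreover have "w (Suc (Suc l)) < n + P" using x'(2) xn(1) by linarith
        ultimately show ?thesis using level_less by simp
      next
        assume "m \<in> (\<lambda>m. m + P) ` ?S"
        then show ?thesis using ord xn(2) by auto
      qed
    qed
    then have "card {m. \<pi> m < \<pi> (n + P)} = card {..?x + P} + card ((\<lambda>m. m + P) ` ?S)"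
      using fin by (simp only:) (rule card_Un_disjoint, auto)
    also have "card ((\<lambda>m. m + P) ` ?S) = card ?S" by (rule card_image) (simp add: inj_on_def)
    finally show ?thesis using 1 by (simp add: card_below)
  qed
  then show ?thesis using P(1) by blast
qed

end

section \<open>The dichotomy for finitely based natural classes\<close>

theorem theorem2:
  fixes X :: "nat list set"
  assumes "natural_class X" and "finitely_based X"
  shows "(\<exists>\<gamma> S. fin_perm \<gamma> \<and> closed_class S \<and> sum_complete S \<and> X = Sub_fin \<gamma> \<oplus>\<^sub>C S \<and>
            (\<forall>\<gamma>' S'. fin_perm \<gamma>' \<and> closed_class S' \<and> sum_complete S' \<and>
                      X = Sub_fin \<gamma>' \<oplus>\<^sub>C S' \<longrightarrow> S' = S))
       \<or> (\<exists>\<pi>. pos_bij \<pi> \<and> X = Sub_inf \<pi> \<and>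
            (\<forall>\<pi>'. pos_bij \<pi>' \<and> X = Sub_inf \<pi>' \<longrightarrow> (\<forall>n\<ge>1. \<pi>' n = \<pi> n)) \<and>
            ultimately_periodic \<pi>)"
proof (cases "\<exists>\<gamma> S. fin_perm \<gamma> \<and> closed_class S \<and> sum_complete S \<and> X = Sub_fin \<gamma> \<oplus>\<^sub>C S")
  case True
  then obtain \<gamma> S where S: "fin_perm \<gamma>" "closed_class S" "sum_complete S" "X = Sub_fin \<gamma> \<oplus>\<^sub>C S"
    by blast
  obtain \<pi> where "pos_bij \<pi>" "X = Sub_inf \<pi>" using assms(1) by (auto simp: natural_class_def)
  then have "\<exists>\<tau>\<in>X. K \<le> length \<tau>" for K using Sub_inf_long by simp
  then have "S' = sum_stabilizer X" if "closed_class S'" "sum_complete S'" "X = Sub_fin \<gamma>' \<oplus>\<^sub>C S'" for \<gamma>' S'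
    using that by (rule sum_stabilizer_unique)
  then show ?thesis using S by metis
next
  case False
  let ?q = "\<lambda>\<pi> n. \<pi> (Suc n) - 1 :: nat"
  \<comment> \<open>Proved for every bijection with class \<open>X\<close>, since uniqueness
    compares two of them. A cut with recurring tail would yield the excluded decomposition.\<close>
  have rooted: "\<exists>b c n0 C. rooted_perm (?q \<pi>) b c n0 C" if \<pi>: "pos_bij \<pi>" "X = Sub_inf \<pi>" for \<pi>
  proof -
    have "finitely_based (Sub_inf \<pi>)" using assms(2) \<pi>(2) by simp
    then obtain b where b: "bounded_basis (?q \<pi>) b" using bounded_basis_exists[OF \<pi>(1)] by blast
    have based: "based_perm (?q \<pi>) b"
      by (intro based_perm.intro nat_perm.intro based_perm_axioms.intro bij_shift \<pi>(1) b)
    have "\<not> (\<exists>c. cut (?q \<pi>) c \<and> (\<forall>A. finite A \<and> A \<subseteq> {c..} \<longrightarrow> recurs (?q \<pi>) (?q \<pi>) A))"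
    proof
      assume "\<exists>c. cut (?q \<pi>) c \<and> (\<forall>A. finite A \<and> A \<subseteq> {c..} \<longrightarrow> recurs (?q \<pi>) (?q \<pi>) A)"
      then obtain c where c: "cut (?q \<pi>) c" "\<And>A. finite A \<Longrightarrow> A \<subseteq> {c..} \<Longrightarrow> recurs (?q \<pi>) (?q \<pi>) A"
        by blast
      have "\<exists>\<gamma> S. fin_perm \<gamma> \<and> closed_class S \<and> sum_complete S \<and> Sub_inf \<pi> = Sub_fin \<gamma> \<oplus>\<^sub>C S"
        by (rule Sub_inf_cut[OF \<pi>(1) c(1)]) (rule c(2))
      then show False using False unfolding \<pi>(2) by (rule notE[rotated])
    qed
    from based_perm.rooted_exists[OF based this] show ?thesis by blast
  qed
  obtain \<pi> where \<pi>: "pos_bij \<pi>" "X = Sub_inf \<pi>" using assms(1) by (auto simp: natural_class_def)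
  obtain b c n0 C where R: "rooted_perm (?q \<pi>) b c n0 C" using rooted[OF \<pi>] by blast
  have pos: "1 \<le> \<pi>' (Suc n)" if "pos_bij \<pi>'" for \<pi>' n
    using that by (auto simp: pos_bij_def bij_betw_def)
  have "\<pi>' n = \<pi> n" if \<pi>': "pos_bij \<pi>'" "X = Sub_inf \<pi>'" and n: "1 \<le> n" for \<pi>' n
  proof -
    obtain b' c' n0' C' where R': "rooted_perm (?q \<pi>') b' c' n0' C'" using rooted[OF \<pi>'] by blast
    have "?q \<pi> = ?q \<pi>'"
      by (rule rooted_perm_unique[OF R R']) (rule occurs_transfer[OF \<pi>(1) \<pi>'(1)], use \<pi>(2) \<pi>'(2) in simp_all)
    then have "\<pi> (Suc (n - 1)) - 1 = \<pi>' (Suc (n - 1)) - 1" by metis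
    then show ?thesis using pos[OF \<pi>(1), of "n - 1"] pos[OF \<pi>'(1), of "n - 1"] n by simp
  qed
  moreover have "ultimately_periodic \<pi>"
  proof -
    obtain P N where P: "0 < P" "\<And>n. N \<le> n \<Longrightarrow> ?q \<pi> (n + P) = ?q \<pi> n + P"
      using rooted_perm.periodic[OF R] by blast
    \<comment> \<open>The shift of indices turns the threshold \<open>N\<close> into
      \<open>Suc N\<close>.\<close>
    have "\<pi> (n + P) = \<pi> n + P" if n: "1 \<le> n" "int (Suc N) \<le> int n" for n
    proof -
      obtain m where "n = Suc m" "N \<le> m" using n by (cases n) auto
      then show ?thesis using P(2)[of m] pos[OF \<pi>(1), of m] pos[OF \<pi>(1), of "m + P"] by simp
    qed
    then show ?thesis unfolding ultimately_periodic_def using P(1) by blast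
  qed
  ultimately show ?thesis using \<pi> by blast
qed

end
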